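(* Let $n$ be any integer greater than two. There exists an immersed $n$-sphere $A\subset\mathbb{R}^{n+1}\times\{0\}$ which does not lift into $\mathbb{R}^{n+1}\times\mathbb{R}$.
   Context: Everything is in the smooth category. An $n$-knot is a smooth oriented submanifold $K$ of $\mathbb{R}^{n+1}\times\mathbb{R}$ which is PL homeomorphic to the standard $n$-sphere. Let $\pi:\mathbb{R}^{n+1}\times\mathbb{R}\to\mathbb{R}^{n+1}\times\{0\}$ be the natural projection map. For an $n$-knot $K$ such that $\pi|_K$ is a self-transverse immersion, the projection of $K$ is $\pi|_K(K)$. An immersed $n$-sphere is the image of a self-transverse immersion $S^n\to\mathbb{R}^{n+1}$; we regard it as a subset of $\mathbb{R}^{n+1}\times\{0\}$, identified with $\mathbb{R}^{n+1}$. An immersed $n$-sphere $A$ lifts (into $\mathbb{R}^{n+1}\times\mathbb{R}$) if there is an $n$-knot $K$ such that $\pi|_K$ is a self-transverse immersion and the projection of $K$ is $A$. *)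

theory Defs
  imports "HOL-Analysis.Analysis"
begin

section \<open>Smooth maps and submanifolds\<close>

text \<open>\<open>C_upto k U f\<close>: \<open>f\<close> is of class \<open>C\<^sup>k\<close> on the set \<open>U\<close>, which is meant to be open.\<close>

primrec C_upto :: "nat \<Rightarrow> 'a::real_normed_vector set \<Rightarrow> ('a \<Rightarrow> 'b::real_normed_vector) \<Rightarrow> bool" where
  "C_upto 0 U f \<longleftrightarrow> continuous_on U f"
| "C_upto (Suc k) U f \<longleftrightarrow>
     f differentiable_on U \<and> (\<forall>v. C_upto k U (\<lambda>x. frechet_derivative f (at x) v))"

definition smooth_on_open :: "'a::real_normed_vector set \<Rightarrow> ('a \<Rightarrow> 'b::real_normed_vector) \<Rightarrow> bool" where
  "smooth_on_open U f \<longleftrightarrow> open U \<and> (\<forall>k. C_upto k U f)"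

text \<open>Smoothness on an arbitrary subset of Euclidean space: local smooth extendability.\<close>

definition smooth_map :: "'a::euclidean_space set \<Rightarrow> ('a \<Rightarrow> 'b::euclidean_space) \<Rightarrow> bool" where
  "smooth_map M f \<longleftrightarrow>
     (\<forall>x\<in>M. \<exists>U g. x \<in> U \<and> smooth_on_open U g \<and> (\<forall>y\<in>M \<inter> U. g y = f y))"

definition smooth_submanifold :: "nat \<Rightarrow> 'a::euclidean_space set \<Rightarrow> bool" where
  "smooth_submanifold n M \<longleftrightarrow>
     (\<forall>p\<in>M. \<exists>U V \<phi> \<psi> L. p \<in> U \<and> smooth_on_open U \<phi> \<and> smooth_on_open V \<psi> \<and>
        homeomorphism U V \<phi> \<psi> \<and>
        subspace (L :: 'a set) \<and> dim L = n \<and> \<phi> ` (U \<inter> M) = V \<inter> L)"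

text \<open>The tangent space consists of the velocities of smooth curves in \<open>M\<close> through \<open>p\<close>.\<close>

definition tangent_space :: "'a::euclidean_space set \<Rightarrow> 'a \<Rightarrow> 'a set" where
  "tangent_space M p =
     {v. \<exists>\<gamma> e. (0::real) < e \<and> smooth_on_open {-e<..<e} \<gamma> \<and> \<gamma> ` {-e<..<e} \<subseteq> M \<and>
            \<gamma> 0 = p \<and> (\<gamma> has_vector_derivative v) (at 0)}"

text \<open>
  The differential of a map \<open>f\<close> that is smooth on \<open>M\<close>. A derivative of \<open>f\<close> at \<open>x\<close> within \<open>M\<close> is
  in general not unique as a linear map on the ambient space, but all choices agree on
  \<open>tangent_space M x\<close>; the differential is only ever applied to tangent vectors.
\<close>

definition differential :: "'a::euclidean_space set \<Rightarrow> ('a \<Rightarrow> 'b::euclidean_space) \<Rightarrow> 'a \<Rightarrow> 'a \<Rightarrow> 'b" where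
  "differential M f x = frechet_derivative f (at x within M)"

definition immersion :: "'a::euclidean_space set \<Rightarrow> ('a \<Rightarrow> 'b::euclidean_space) \<Rightarrow> bool" where
  "immersion M f \<longleftrightarrow>
     smooth_map M f \<and> (\<forall>x\<in>M. inj_on (differential M f x) (tangent_space M x))"

text \<open>
  Self-transversality, for multiple points of all orders: if \<open>X\<close> is a set of \<open>r\<close> distinct points
  with a common image, the \<open>r\<close>-fold product \<open>f \<times> \<dots> \<times> f\<close> is transverse to the
  diagonal of the \<open>r\<close>-fold product of the target at the corresponding point. So every vector
  \<open>w\<close> of the product is the sum of a diagonal vector \<open>u\<close> and one in the image of the differential.
\<close>

definition self_transverse_immersion ::
    "'a::euclidean_space set \<Rightarrow> ('a \<Rightarrow> 'b::euclidean_space) \<Rightarrow> bool" where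
  "self_transverse_immersion M f \<longleftrightarrow>
     immersion M f \<and>
     (\<forall>X w. finite X \<and> X \<subseteq> M \<and> (\<forall>x\<in>X. \<forall>y\<in>X. f x = f y) \<longrightarrow>
        (\<exists>u t. \<forall>x\<in>X. t x \<in> tangent_space M x \<and> w x = u + differential M f x (t x)))"


section \<open>Orientations\<close>

text \<open>Ordered bases of a subspace.\<close>

definition frame :: "'a::euclidean_space set \<Rightarrow> 'a list \<Rightarrow> bool" where
  "frame V bs \<longleftrightarrow> distinct bs \<and> independent (set bs) \<and> span (set bs) = V"

text \<open>
  The Leibniz formula for the determinant of an \<open>n \<times> n\<close> matrix with indices below \<open>n\<close>;
  the constant \<^const>\<open>det\<close> only covers matrices indexed by a finite type.
\<close>

definition nat_det :: "nat \<Rightarrow> (nat \<Rightarrow> nat \<Rightarrow> real) \<Rightarrow> real" where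
  "nat_det n a = (\<Sum>p | p permutes {..<n}. of_int (sign p) * (\<Prod>i<n. a i (p i)))"

definition same_orientation :: "'a::euclidean_space list \<Rightarrow> 'a list \<Rightarrow> bool" where
  "same_orientation bs cs \<longleftrightarrow>
     length bs = length cs \<and>
     (\<exists>a. (\<forall>j<length bs. cs ! j = (\<Sum>i<length bs. a i j *\<^sub>R bs ! i)) \<and> 0 < nat_det (length bs) a)"

text \<open>An orientation of a vector space, given as the set of its positively oriented frames.\<close>

definition vector_orientation :: "'a::euclidean_space set \<Rightarrow> 'a list set \<Rightarrow> bool" where
  "vector_orientation V Or \<longleftrightarrow>
     (\<exists>bs. frame V bs \<and> Or = {cs. frame V cs \<and> same_orientation bs cs})"

text \<open>
  An orientation of an \<open>n\<close>-dimensional submanifold orients every tangent space in such a way that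
  every point has a neighbourhood with a continuous positively oriented frame field.
\<close>

definition orientation :: "nat \<Rightarrow> 'a::euclidean_space set \<Rightarrow> ('a \<Rightarrow> 'a list set) \<Rightarrow> bool" where
  "orientation n M Or \<longleftrightarrow>
     (\<forall>p\<in>M. vector_orientation (tangent_space M p) (Or p)) \<and>
     (\<forall>p\<in>M. \<exists>U E. open U \<and> p \<in> U \<and> (\<forall>i<n. continuous_on (M \<inter> U) (E i)) \<and>
        (\<forall>q\<in>M \<inter> U. map (\<lambda>i. E i q) [0..<n] \<in> Or q))"


section \<open>The PL structure of a smooth manifold\<close>

definition pl_homeomorphic :: "'a::euclidean_space set \<Rightarrow> 'b::euclidean_space set \<Rightarrow> bool" where
  "pl_homeomorphic P Q \<longleftrightarrow>
     (\<exists>T f g. simplicial_complex T \<and> \<Union>T = P \<and> homeomorphism P Q f g \<and>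
        (\<forall>S\<in>T. \<exists>l c. linear l \<and> (\<forall>x\<in>S. f x = c + l x)))"

text \<open>
  A smooth (Whitehead) triangulation \<open>t : |T| \<rightarrow> M\<close>: a homeomorphism that is smooth with injective
  differential on every closed simplex. The span below is the direction space of the simplex \<open>S\<close>;
  on it the derivative within \<open>S\<close> is unique.
\<close>

definition smooth_triangulation ::
    "'a::euclidean_space set set \<Rightarrow> ('a \<Rightarrow> 'b::euclidean_space) \<Rightarrow> 'b set \<Rightarrow> bool" where
  "smooth_triangulation T t M \<longleftrightarrow>
     simplicial_complex T \<and> (\<exists>s. homeomorphism (\<Union>T) M t s) \<and>
     (\<forall>S\<in>T. smooth_map S t \<and>
        (\<forall>x\<in>S. inj_on (frechet_derivative t (at x within S)) (span ((\<lambda>y. y - x) ` S))))"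

text \<open>
  A smooth manifold carries the PL structure of its smooth triangulations, which by Whitehead is
  unique up to PL homeomorphism; the standard PL \<open>n\<close>-sphere is the boundary of an \<open>(n+1)\<close>-simplex.
  Taking the complex \<open>T\<close> in the ambient space of \<open>M\<close> is no restriction for submanifolds of
  positive codimension: a polyhedron PL homeomorphic to that boundary can be replaced by the
  boundary of a simplex, suitably subdivided.
\<close>

definition pl_homeomorphic_to_sphere :: "nat \<Rightarrow> 'a::euclidean_space set \<Rightarrow> bool" where
  "pl_homeomorphic_to_sphere n M \<longleftrightarrow>
     (\<exists>(T :: 'a set set) t (\<Delta> :: 'a set).
        smooth_triangulation T t M \<and> (int n + 1) simplex \<Delta> \<and>
        pl_homeomorphic (\<Union>T) (rel_frontier \<Delta>))"


section \<open>Knots and immersed spheres\<close>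

text \<open>In the following the type \<open>'a\<close> plays the role of \<open>(n+1)\<close>-dimensional Euclidean space.\<close>

definition n_knot ::
    "nat \<Rightarrow> ('a::euclidean_space \<times> real) set \<Rightarrow> ('a \<times> real \<Rightarrow> ('a \<times> real) list set) \<Rightarrow> bool" where
  "n_knot n K Or \<longleftrightarrow>
     smooth_submanifold n K \<and> orientation n K Or \<and> pl_homeomorphic_to_sphere n K"

definition immersed_sphere :: "'a::euclidean_space set \<Rightarrow> bool" where
  "immersed_sphere A \<longleftrightarrow>
     (\<exists>f :: 'a \<Rightarrow> 'a. self_transverse_immersion (sphere 0 1) f \<and> A = f ` sphere 0 1)"

text \<open>
  The hyperplane \<open>'a \<times> {0}\<close> is identified with \<open>'a\<close>, so that the projection onto it is \<^const>\<open>fst\<close>.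
\<close>

definition lifts :: "nat \<Rightarrow> 'a::euclidean_space set \<Rightarrow> bool" where
  "lifts n A \<longleftrightarrow>
     (\<exists>(K :: ('a \<times> real) set) Or. n_knot n K Or \<and> self_transverse_immersion K fst \<and> fst ` K = A)"

end

theory Submission
  imports Defs
begin

text \<open>
  Let an immersion \<open>f\<close> of the sphere have a closed curve of double points along which the two sheets
  are exchanged. A lift assigns to each sheet a height, which depends continuously on the point of
  the sheet and differs on the two sheets; going once around the curve reverses the sign of the
  difference of the heights, so there is no lift.

  Such an immersion arises from the standard sphere in \<open>\<complex> \<times> \<complex> \<times> \<real>\<^sup>n\<^sup>-\<^sup>3\<close> when a neighbourhood of a
  curve \<open>{(r e\<^sup>i\<^sup>t, s e\<^sup>2\<^sup>i\<^sup>t, 0)}\<close> is pushed through itself along the Moebius band that the curve bounds with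
  core \<open>z = 0\<close>. This is achieved by
  \<open>(z, w, v) \<mapsto> (z - 5/3 z\<^sup>3 cnj w - 2 (cnj z)\<^sup>3 w\<^sup>2, w, v)\<close>: writing \<open>z = \<surd>w (X + i Y)\<close>, the pushing takes
  place in the direction of \<open>X\<close> only, in the sense that the component along \<open>i \<surd>w\<close> remains strictly
  increasing in \<open>Y\<close>. So the double points are pairs that differ in the sign of \<open>X\<close>, there are no
  triple points, and running once around the circle of \<open>w\<close> exchanges the two signs.
\<close>

section \<open>Smooth maps\<close>

lemma C_upto_SucD:
  assumes "open U" and "C_upto (Suc k) U f" and "x \<in> U"
  shows "(f has_derivative frechet_derivative f (at x)) (at x)"
proof -
  have "f differentiable (at x within U)"
    using assms(2,3) by (simp add: differentiable_on_def)
  then show ?thesis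
    using at_within_open[OF assms(3,1)] by (metis frechet_derivative_works)
qed

lemma C_upto_cong:
  assumes "open U" and "\<And>x. x \<in> U \<Longrightarrow> f x = g x" and "C_upto k U f"
  shows "C_upto k U g"
  using assms
proof (induction k arbitrary: f g)
  case 0
  then show ?case by (simp cong: continuous_on_cong)
next
  case (Suc k)
  have der: "(g has_derivative frechet_derivative f (at x)) (at x)" if "x \<in> U" for x
    using has_derivative_transform_within_open[OF C_upto_SucD[OF Suc.prems(1,3) that] Suc.prems(1) that]
      Suc.prems(2) by blast
  have "C_upto k U (\<lambda>x. frechet_derivative g (at x) v)" for v
  proof (rule Suc.IH[of "\<lambda>x. frechet_derivative f (at x) v"])
    show "frechet_derivative f (at x) v = frechet_derivative g (at x) v" if "x \<in> U" for x
      using frechet_derivative_at[OF der[OF that]] by metis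
  qed (use Suc.prems in auto)
  moreover have "g differentiable_on U"
    using der by (auto simp: differentiable_on_def differentiable_def intro: has_derivative_at_withinI)
  ultimately show ?case by simp
qed

text \<open>The recursion of \<open>C_upto\<close> refers to \<open>frechet_derivative\<close>.
  Derivatives at interior points are unique, so any explicit derivative may take its place, and the
  closure rules can work with formulas.\<close>

lemma C_upto_deriv:
  assumes "open U" and der: "\<And>x. x \<in> U \<Longrightarrow> (f has_derivative f' x) (at x)"
    and "\<And>v. C_upto k U (\<lambda>x. f' x v)"
  shows "C_upto (Suc k) U f"
proof -
  have "C_upto k U (\<lambda>x. frechet_derivative f (at x) v)" for v
    by (rule C_upto_cong[OF assms(1) _ assms(3)[of v]]) (metis der frechet_derivative_at)
  moreover have "f differentiable_on U"
    using der by (auto simp: differentiable_on_def differentiable_def intro: has_derivative_at_withinI)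
  ultimately show ?thesis by simp
qed

lemma C_upto_Suc_imp: "open U \<Longrightarrow> C_upto (Suc k) U f \<Longrightarrow> C_upto k U f"
proof (induction k arbitrary: f)
  case 0
  then show ?case by (simp add: differentiable_imp_continuous_on)
next
  case (Suc k)
  then show ?case by (metis C_upto.simps(2))
qed

lemma C_upto_const: "open U \<Longrightarrow> C_upto k U (\<lambda>x. c)"
proof (induction k arbitrary: c)
  case (Suc k)
  show ?case by (rule C_upto_deriv[where f' = "\<lambda>x v. 0"]) (use Suc in auto)
qed simp

lemma C_upto_bounded_linear: "open U \<Longrightarrow> bounded_linear L \<Longrightarrow> C_upto k U L"
proof (cases k)
  case 0
  then show "bounded_linear L \<Longrightarrow> ?thesis" by (simp add: linear_continuous_on)
next
  case (Suc k')
  assume "open U" "bounded_linear L"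
  then show ?thesis unfolding Suc
    by (intro C_upto_deriv[where f' = "\<lambda>x. L"])
      (auto intro: bounded_linear_imp_has_derivative C_upto_const)
qed

lemma C_upto_compose_linear:
  assumes "open U" "bounded_linear L" "C_upto k U f"
  shows "C_upto k U (\<lambda>x. L (f x))"
  using assms
proof (induction k arbitrary: f)
  case 0
  then show ?case by (simp add: bounded_linear.continuous_on)
next
  case (Suc k)
  show ?case
    by (rule C_upto_deriv[OF Suc.prems(1)
          bounded_linear.has_derivative[OF Suc.prems(2) C_upto_SucD[OF Suc.prems(1,3)]]])
      (use Suc in auto)
qed

lemma C_upto_add:
  assumes "open U" "C_upto k U f" "C_upto k U g"
  shows "C_upto k U (\<lambda>x. f x + g x)"
  using assms
proof (induction k arbitrary: f g)
  case 0
  then show ?case by (simp add: continuous_on_add)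
next
  case (Suc k)
  show ?case
    by (rule C_upto_deriv[OF Suc.prems(1) has_derivative_add[OF
            C_upto_SucD[OF Suc.prems(1,2)] C_upto_SucD[OF Suc.prems(1,3)]]])
      (use Suc in auto)
qed

lemma C_upto_mult:
  fixes f g :: "'a::real_normed_vector \<Rightarrow> 'b::real_normed_algebra"
  assumes "open U" "C_upto k U f" "C_upto k U g"
  shows "C_upto k U (\<lambda>x. f x * g x)"
  using assms
proof (induction k arbitrary: f g)
  case 0
  then show ?case by (simp add: continuous_on_mult)
next
  case (Suc k)
  \<comment> \<open>The product rule contains the factors themselves next to their derivatives, so
    \<open>f\<close> and \<open>g\<close> are also needed one order lower.\<close>
  note lower = C_upto_Suc_imp[OF Suc.prems(1,2)] C_upto_Suc_imp[OF Suc.prems(1,3)]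
  show ?case
    by (rule C_upto_deriv[OF Suc.prems(1) has_derivative_mult[OF
            C_upto_SucD[OF Suc.prems(1,2)] C_upto_SucD[OF Suc.prems(1,3)]]])
      (use Suc.IH Suc.prems lower in \<open>auto intro!: C_upto_add\<close>)
qed

lemma C_upto_power:
  fixes f :: "'a::real_normed_vector \<Rightarrow> 'b::{real_normed_algebra,monoid_mult}"
  assumes "open U" "C_upto k U f"
  shows "C_upto k U (\<lambda>x. f x ^ m)"
  by (induction m) (auto intro: C_upto_const C_upto_mult assms)

lemma C_upto_along_line:
  fixes f :: "'a::real_normed_vector \<Rightarrow> 'b::real_normed_vector"
  assumes "open U" "open I" "\<And>t. t \<in> I \<Longrightarrow> a + t *\<^sub>R b \<in> U" "C_upto k U f"
  shows "C_upto k I (\<lambda>t. f (a + t *\<^sub>R b))"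
  using assms
proof (induction k arbitrary: f)
  case 0
  then show ?case
    by (auto intro!: continuous_intros continuous_on_compose2[of U f I "\<lambda>t. a + t *\<^sub>R b"])
next
  case (Suc k)
  let ?f' = "\<lambda>x. frechet_derivative f (at x)"
  have der: "((\<lambda>t. f (a + t *\<^sub>R b)) has_derivative (\<lambda>s. ?f' (a + t *\<^sub>R b) (s *\<^sub>R b))) (at t)"
    if "t \<in> I" for t
  proof (rule has_derivative_compose[where g = f])
    show "((\<lambda>t. a + t *\<^sub>R b) has_derivative (\<lambda>s. s *\<^sub>R b)) (at t)"
      by (auto intro!: derivative_eq_intros)
    show "(f has_derivative ?f' (a + t *\<^sub>R b)) (at (a + t *\<^sub>R b))"
      using C_upto_SucD[OF Suc.prems(1,4)] Suc.prems(3)[OF that] by blast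
  qed
  show ?case
    by (rule C_upto_deriv[OF Suc.prems(2) der])
      (use Suc in auto)
qed

section \<open>Tangent spaces\<close>

text \<open>Composed with a curve in \<open>M\<close> of velocity \<open>v\<close>, either
  derivative computes the velocity of the same image curve at the interior time 0, where it is
  unique.\<close>

lemma derivative_unique_on_tangent_space:
  assumes A: "(f has_derivative A) (at x within M)" and B: "(f has_derivative B) (at x within M)"
    and v: "v \<in> tangent_space M x"
  shows "A v = B v"
proof -
  obtain \<gamma> e where g: "(0::real) < e" "\<gamma> ` {-e<..<e} \<subseteq> M" "\<gamma> 0 = x"
      "(\<gamma> has_vector_derivative v) (at 0)"
    using v unfolding tangent_space_def by blast
  have gd: "(\<gamma> has_derivative (\<lambda>s. s *\<^sub>R v)) (at 0 within {-e<..<e})"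
    using g(4) has_derivative_at_withinI unfolding has_vector_derivative_def by blast
  have comp: "((\<lambda>t. f (\<gamma> t)) has_vector_derivative C v) (at 0)"
    if "(f has_derivative C) (at x within M)" for C
  proof -
    have "(f has_derivative C) (at (\<gamma> 0) within \<gamma> ` {-e<..<e})"
      using that g has_derivative_subset by metis
    from has_derivative_in_compose[OF gd this]
    have "((\<lambda>t. f (\<gamma> t)) has_derivative (\<lambda>s. C (s *\<^sub>R v))) (at 0)"
      using g(1) by (simp add: at_within_open[of 0 "{-e<..<e}"])
    then show ?thesis
      unfolding has_vector_derivative_def
      using that by (simp add: has_derivative_bounded_linear linear_simps)
  qed
  show ?thesis
    using vector_derivative_unique_at[OF comp[OF A] comp[OF B]] .
qed

lemma differential_tangent:
  assumes "(f has_derivative A) (at x within M)" and "v \<in> tangent_space M x"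
  shows "differential M f x v = A v"
  unfolding differential_def
  using assms by (intro derivative_unique_on_tangent_space[of f _ x M])
     (auto simp: frechet_derivative_works[symmetric] intro: differentiableI)

text \<open>Differentiation replaces the pair \<open>x\<close>, \<open>y\<close> by multiples of
  \<open>y\<close> and \<open>- x\<close>, so an induction over arbitrary vectors closes up.\<close>

lemma C_upto_great_circle:
  "C_upto k UNIV (\<lambda>t::real. cos (c * t) *\<^sub>R x + sin (c * t) *\<^sub>R y)"
proof (induction k arbitrary: x y)
  case 0
  then show ?case by (auto intro!: continuous_intros)
next
  case (Suc k)
  show ?case
  proof (rule C_upto_deriv)
    fix t :: real
    show "((\<lambda>t. cos (c * t) *\<^sub>R x + sin (c * t) *\<^sub>R y) has_derivative
        (\<lambda>s. cos (c * t) *\<^sub>R ((s * c) *\<^sub>R y) + sin (c * t) *\<^sub>R (- (s * c) *\<^sub>R x))) (at t)"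
      by (auto intro!: derivative_eq_intros simp: algebra_simps)
    show "C_upto k UNIV
        (\<lambda>t. cos (c * t) *\<^sub>R ((s * c) *\<^sub>R y) + sin (c * t) *\<^sub>R (- (s * c) *\<^sub>R x))" for s
      by (rule Suc.IH)
  qed simp
qed

text \<open>Differentiating \<open>\<gamma> t \<bullet> \<gamma> t = 1\<close> gives one inclusion,
  the great circle with initial velocity \<open>v\<close> the other.\<close>

lemma tangent_space_sphere:
  fixes x :: "'a::euclidean_space"
  assumes "norm x = 1"
  shows "tangent_space (sphere 0 1) x = {h. x \<bullet> h = 0}"
proof (intro set_eqI iffI)
  fix v assume "v \<in> tangent_space (sphere 0 1) x"
  then obtain \<gamma> e where g: "(0::real) < e" "\<gamma> ` {-e<..<e} \<subseteq> sphere 0 1" "\<gamma> 0 = x"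
      "(\<gamma> has_derivative (\<lambda>s. s *\<^sub>R v)) (at 0)"
    unfolding tangent_space_def has_vector_derivative_def by blast
  have one: "\<gamma> t \<bullet> \<gamma> t = 1" if "t \<in> {-e<..<e}" for t
    using g(2) that by (auto simp: dot_square_norm image_subset_iff)
  have "((\<lambda>t. \<gamma> t \<bullet> \<gamma> t) has_derivative (\<lambda>s. \<gamma> 0 \<bullet> (s *\<^sub>R v) + (s *\<^sub>R v) \<bullet> \<gamma> 0)) (at 0)"
    by (rule has_derivative_inner[OF g(4) g(4)])
  moreover have "((\<lambda>t. \<gamma> t \<bullet> \<gamma> t) has_derivative (\<lambda>s. 0)) (at 0)"
    by (rule has_derivative_transform_within_open[of "\<lambda>t. 1" _ _ _ "{-e<..<e}"])
      (use g(1) one in auto)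
  ultimately have "(\<lambda>s. \<gamma> 0 \<bullet> (s *\<^sub>R v) + (s *\<^sub>R v) \<bullet> \<gamma> 0) = (\<lambda>s. 0)"
    by (rule has_derivative_unique)
  from fun_cong[OF this, of 1] show "v \<in> {h. x \<bullet> h = 0}"
    by (simp add: g(3) inner_commute)
next
  fix v assume "v \<in> {h. x \<bullet> h = 0}"
  then have v: "x \<bullet> v = 0" by simp
  define c where "c = norm v"
  define y where "y = (1 / c) *\<^sub>R v"
  define \<gamma> where "\<gamma> = (\<lambda>t::real. cos (c * t) *\<^sub>R x + sin (c * t) *\<^sub>R y)"
  have cy: "c *\<^sub>R y = v" unfolding y_def c_def by auto
  have xy: "x \<bullet> y = 0" using v by (simp add: y_def)
  \<comment> \<open>For \<open>v = 0\<close> the convention 1/0 = 0 makes \<open>y\<close> zero; the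
    curve is then constant.\<close>
  have yy: "y \<bullet> y = 1 \<or> c = 0"
    by (auto simp: y_def c_def power2_norm_eq_inner[symmetric] power2_eq_square)
  have sph: "\<gamma> t \<in> sphere 0 1" for t
  proof -
    have "\<gamma> t \<bullet> \<gamma> t = cos (c * t)^2 * (x \<bullet> x) + sin (c * t)^2 * (y \<bullet> y)"
      unfolding \<gamma>_def by (simp add: inner_add inner_commute[of y x] xy power2_eq_square)
    also have "\<dots> = 1"
      using yy assms by (auto simp: dot_square_norm)
    finally show ?thesis by (simp add: norm_eq_1)
  qed
  have "(\<gamma> has_derivative (\<lambda>s. s *\<^sub>R v)) (at 0)"
    unfolding \<gamma>_def cy[symmetric] by (auto intro!: derivative_eq_intros)
  moreover have "smooth_on_open {-1<..<1} \<gamma>"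
    unfolding smooth_on_open_def \<gamma>_def
    using C_upto_along_line[OF _ _ _ C_upto_great_circle, of "{-1<..<1}" 0 1] by auto
  ultimately show "v \<in> tangent_space (sphere 0 1) x"
    unfolding tangent_space_def has_vector_derivative_def
    using sph by (intro CollectI exI[of _ \<gamma>] exI[of _ 1]) (auto simp: \<gamma>_def simp del: mem_sphere_0)
qed

section \<open>Difference quotients along sequences\<close>

text \<open>The increments need not lie on a line or a curve, only their directions converge. This
  suits sequences of preimages that are found by compactness.\<close>

lemma directional_limit:
  fixes f :: "'a::real_normed_vector \<Rightarrow> 'b::real_normed_vector"
  assumes "(f has_derivative D) (at x)" and "\<And>i::nat. h i \<noteq> 0" and h0: "h \<longlonglongrightarrow> 0"
    and d: "(\<lambda>i. h i /\<^sub>R norm (h i)) \<longlonglongrightarrow> d"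
  shows "(\<lambda>i. (f (x + h i) - f x) /\<^sub>R norm (h i)) \<longlonglongrightarrow> D d"
proof -
  have bl: "bounded_linear D" and lim: "(\<lambda>h. norm (f (x + h) - f x - D h) / norm h) \<midarrow>0\<rightarrow> 0"
    using assms(1) by (auto simp: has_derivative_at)
  have "(\<lambda>i. norm (f (x + h i) - f x - D (h i)) / norm (h i)) \<longlonglongrightarrow> 0"
    using filterlim_compose[OF lim filterlim_atI[OF h0]] assms(2) by simp
  then have "(\<lambda>i. norm ((f (x + h i) - f x - D (h i)) /\<^sub>R norm (h i))) \<longlonglongrightarrow> 0"
    by (simp add: divide_inverse_commute)
  then have "(\<lambda>i. (f (x + h i) - f x - D (h i)) /\<^sub>R norm (h i)) \<longlonglongrightarrow> 0"
    by (rule tendsto_norm_zero_cancel)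
  moreover have "(\<lambda>i. D (h i /\<^sub>R norm (h i))) \<longlonglongrightarrow> D d"
    by (rule bounded_linear.tendsto[OF bl d])
  ultimately have "(\<lambda>i. (f (x + h i) - f x - D (h i)) /\<^sub>R norm (h i) + D (h i /\<^sub>R norm (h i)))
      \<longlonglongrightarrow> 0 + D d"
    by (rule tendsto_add)
  then show ?thesis
    using bl by (simp add: linear_simps scaleR_diff_right)
qed

corollary curve_limit:
  assumes "(c has_vector_derivative v) (at (0::real))" and "\<And>i::nat. s i > 0" and "s \<longlonglongrightarrow> 0"
  shows "(\<lambda>i. (c (s i) - c 0) /\<^sub>R s i) \<longlonglongrightarrow> v"
proof -
  have s: "s i /\<^sub>R norm (s i) = 1" "norm (s i) = s i" "s i \<noteq> 0" for i
    using assms(2)[of i] by auto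
  have "(\<lambda>i. s i /\<^sub>R norm (s i)) \<longlonglongrightarrow> 1" unfolding s(1) by simp
  from directional_limit[OF assms(1)[unfolded has_vector_derivative_def] s(3) assms(3) this]
  show ?thesis unfolding s(2) by simp
qed

section \<open>Tangent spaces of submanifolds\<close>

text \<open>The derivatives of \<open>\<phi>\<close> and \<open>\<psi>\<close> are inverse to each
  other. Segments in \<open>L\<close> are carried by \<open>\<psi>\<close> to curves in
  \<open>K\<close>; conversely a curve in \<open>K\<close> has, in the chart, difference quotients
  in the closed subspace \<open>L\<close>.\<close>

lemma tangent_space_chart:
  fixes K :: "'a::euclidean_space set" and \<phi> \<psi> :: "'a \<Rightarrow> 'a"
  assumes "smooth_on_open U \<phi>" "smooth_on_open V \<psi>" and hom: "homeomorphism U V \<phi> \<psi>"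
    and L: "subspace L" and img: "\<phi> ` (U \<inter> K) = V \<inter> L" and k: "k \<in> U \<inter> K"
  shows "tangent_space K k = frechet_derivative \<psi> (at (\<phi> k)) ` L"
    and "inj_on (frechet_derivative \<psi> (at (\<phi> k))) L"
proof -
  let ?D = "frechet_derivative \<psi> (at (\<phi> k))" and ?E = "frechet_derivative \<phi> (at k)"
  have U: "open U" "C_upto j U \<phi>" and V: "open V" "C_upto j V \<psi>" for j
    using assms(1,2) by (auto simp: smooth_on_open_def)
  have pk: "\<phi> k \<in> V" "\<phi> k \<in> L" "\<psi> (\<phi> k) = k" using k img hom by (auto simp: homeomorphism_def)
  have dpsi: "(\<psi> has_derivative ?D) (at (\<phi> k))"
    by (rule C_upto_SucD[OF V pk(1)])
  have dphi: "(\<phi> has_derivative ?E) (at k)"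
    by (rule C_upto_SucD[OF U]) (use k in auto)
  have DE: "?D (?E v) = v" for v
  proof -
    have "((\<lambda>x. \<psi> (\<phi> x)) has_derivative (\<lambda>v. ?D (?E v))) (at k)"
      by (rule has_derivative_compose[OF dphi dpsi])
    moreover have "((\<lambda>x. \<psi> (\<phi> x)) has_derivative (\<lambda>v. v)) (at k)"
      by (rule has_derivative_transform_within_open[OF has_derivative_ident U(1)])
        (use k hom in \<open>auto simp: homeomorphism_def\<close>)
    ultimately show ?thesis using has_derivative_unique by metis
  qed
  have ED: "?E (?D v) = v" for v
  proof -
    have "((\<lambda>x. \<phi> (\<psi> x)) has_derivative (\<lambda>v. ?E (?D v))) (at (\<phi> k))"
      by (rule has_derivative_compose[OF dpsi]) (use dphi pk in simp)
    moreover have "((\<lambda>x. \<phi> (\<psi> x)) has_derivative (\<lambda>v. v)) (at (\<phi> k))"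
      by (rule has_derivative_transform_within_open[OF has_derivative_ident V(1)])
        (use pk hom in \<open>auto simp: homeomorphism_def\<close>)
    ultimately show ?thesis using has_derivative_unique by metis
  qed
  show "inj_on ?D L" by (rule inj_on_inverseI[of _ ?E]) (rule ED)
  show "tangent_space K k = ?D ` L"
  proof (intro subset_antisym subsetI)
    fix v assume "v \<in> ?D ` L"
    then obtain l where l: "l \<in> L" "v = ?D l" by blast
    obtain e where e: "e > 0" "ball (\<phi> k) e \<subseteq> V" using V(1) pk(1) open_contains_ball by blast
    \<comment> \<open>The summand 1 covers the case \<open>l = 0\<close>.\<close>
    define d where "d = e / (norm l + 1)"
    have d: "d > 0" using e by (auto simp: d_def intro!: divide_pos_pos add_nonneg_pos)
    have inV: "\<phi> k + t *\<^sub>R l \<in> V" if "t \<in> {-d<..<d}" for t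
    proof -
      have "\<bar>t\<bar> < e / (norm l + 1)" using that unfolding d_def by auto
      then have "\<bar>t\<bar> * (norm l + 1) < e" by (simp add: pos_less_divide_eq add_nonneg_pos)
      then have "norm (t *\<^sub>R l) < e" by (simp add: algebra_simps)
      then show ?thesis using e by (auto simp: dist_norm subset_eq)
    qed
    have inL: "\<phi> k + t *\<^sub>R l \<in> L" for t
      using L l pk by (simp add: subspace_add subspace_scale)
    let ?g = "\<lambda>t::real. \<psi> (\<phi> k + t *\<^sub>R l)"
    have "smooth_on_open {-d<..<d} ?g"
      unfolding smooth_on_open_def 
      using C_upto_along_line[OF V(1) open_greaterThanLessThan inV V(2)] by simp
    moreover have "?g ` {-d<..<d} \<subseteq> K"
    proof (rule image_subsetI)
      fix t assume "t \<in> {-d<..<d}"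
      then obtain x where "x \<in> U \<inter> K" "\<phi> x = \<phi> k + t *\<^sub>R l" using inV inL img by (metis IntI imageE)
      then show "?g t \<in> K" using hom by (metis IntD1 IntD2 homeomorphism_apply1)
    qed
    moreover have lin: "((\<lambda>t::real. \<phi> k + t *\<^sub>R l) has_derivative (\<lambda>s. s *\<^sub>R l)) (at 0)"
      by (auto intro!: derivative_eq_intros)
    have "(?g has_derivative (\<lambda>s. ?D (s *\<^sub>R l))) (at 0)"
      by (rule has_derivative_compose[OF lin]) (use dpsi in simp)
    then have "(?g has_vector_derivative v) (at 0)"
      unfolding has_vector_derivative_def l
      using dpsi by (simp add: has_derivative_bounded_linear linear_simps)
    ultimately show "v \<in> tangent_space K k"
      unfolding tangent_space_def using d pk(3) by (intro CollectI exI[of _ ?g] exI[of _ d]) auto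
  next
    fix v assume "v \<in> tangent_space K k"
    then obtain \<gamma> e where g: "(0::real) < e" "\<gamma> ` {-e<..<e} \<subseteq> K" "\<gamma> 0 = k"
        "(\<gamma> has_vector_derivative v) (at 0)"
      unfolding tangent_space_def by blast
    have gd: "(\<gamma> has_derivative (\<lambda>s. s *\<^sub>R v)) (at 0)"
      using g(4) unfolding has_vector_derivative_def .
    have "((\<lambda>t. \<phi> (\<gamma> t)) has_derivative (\<lambda>s. ?E (s *\<^sub>R v))) (at 0)"
      by (rule has_derivative_compose[OF gd]) (use dphi g in simp)
    then have cv: "((\<lambda>t. \<phi> (\<gamma> t)) has_vector_derivative ?E v) (at 0)"
      unfolding has_vector_derivative_def
      using dphi by (simp add: has_derivative_bounded_linear linear_simps)
    \<comment> \<open>Denominators start at 2, so that every time lies strictly inside the interval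
      of definition.\<close>
    have s: "(\<lambda>i. e / real (i + 2)) \<longlonglongrightarrow> 0"
      using LIMSEQ_ignore_initial_segment[OF lim_const_over_n[of e], of 2] by simp
    have lim: "(\<lambda>i. (\<phi> (\<gamma> (e / real (i + 2))) - \<phi> k) /\<^sub>R (e / real (i + 2))) \<longlonglongrightarrow> ?E v"
      using curve_limit[OF cv _ s] g by simp
    have "(\<lambda>i. \<gamma> (e / real (i + 2))) \<longlonglongrightarrow> k"
      using isCont_tendsto_compose[OF has_derivative_continuous[OF gd] s] g(3) by simp
    then have "\<forall>\<^sub>F i in sequentially. \<gamma> (e / real (i + 2)) \<in> U"
      using U(1) k topological_tendstoD by blast
    moreover have "\<gamma> (e / real (i + 2)) \<in> K" for i
    proof -
      have "e / real (i + 2) < e / 1" using g(1) by (intro divide_strict_left_mono) auto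
      moreover have "0 < e / real (i + 2)" using g(1) by simp
      ultimately have "e / real (i + 2) \<in> {-e<..<e}"
        unfolding greaterThanLessThan_iff using g(1) by linarith
      then show ?thesis using g(2) by blast
    qed
    ultimately have "\<forall>\<^sub>F i in sequentially. \<phi> (\<gamma> (e / real (i + 2))) \<in> L"
      by (elim eventually_mono) (use img in auto)
    then have "\<forall>\<^sub>F i in sequentially. (\<phi> (\<gamma> (e / real (i + 2))) - \<phi> k) /\<^sub>R (e / real (i + 2)) \<in> L"
      by (rule eventually_mono) (use L pk subspace_diff subspace_scale in blast)
    then have "?E v \<in> L"
      using Lim_in_closed_set[OF closed_subspace[OF L] _ _ lim] by auto
    then show "v \<in> ?D ` L" using DE by (metis image_eqI)
  qed
qed

lemma tangent_space_submanifold: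
  assumes "smooth_submanifold n K" and "k \<in> K"
  shows "subspace (tangent_space K k)" and "dim (tangent_space K k) = n"
proof -
  obtain U V \<phi> \<psi> and L :: "'a set" where ch: "k \<in> U" "smooth_on_open U \<phi>" "smooth_on_open V \<psi>"
      "homeomorphism U V \<phi> \<psi>" "subspace L" "dim L = n" "\<phi> ` (U \<inter> K) = V \<inter> L"
    using assms unfolding smooth_submanifold_def by blast
  note T = tangent_space_chart[OF ch(2-5,7) IntI[OF ch(1) assms(2)]]
  have "\<phi> k \<in> V" using ch(1,4) by (auto simp: homeomorphism_def)
  then have lin: "linear (frechet_derivative \<psi> (at (\<phi> k)))"
    using C_upto_SucD ch(3) has_derivative_linear unfolding smooth_on_open_def by blast
  show "subspace (tangent_space K k)"
    unfolding T(1) by (rule linear_subspace_image[OF lin ch(5)])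
  show "dim (tangent_space K k) = n"
    unfolding T(1) using dim_image_eq[OF lin, of L] T(2) ch(5,6) by (simp add: span_eq_iff[THEN iffD2])
qed

text \<open>In a chart \<open>v\<close> is the image of some \<open>l\<close> in \<open>L\<close>.
  Keeping \<open>l\<close> and moving the base point gives tangent vectors at \<open>q i\<close>,
  and they converge because the derivative of \<open>\<psi>\<close> is continuous.\<close>

lemma tangent_space_lower_semicontinuous:
  fixes K :: "'a::euclidean_space set"
  assumes "smooth_submanifold n K" and "k \<in> K" and "v \<in> tangent_space K k"
    and "\<And>i::nat. q i \<in> K" and q: "q \<longlonglongrightarrow> k"
  obtains u where "u \<longlonglongrightarrow> v" and "\<forall>\<^sub>F i in sequentially. u i \<in> tangent_space K (q i)"
proof -
  obtain U V \<phi> \<psi> and L :: "'a set" where ch: "k \<in> U" "smooth_on_open U \<phi>" "smooth_on_open V \<psi>"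
      "homeomorphism U V \<phi> \<psi>" "subspace L" "dim L = n" "\<phi> ` (U \<inter> K) = V \<inter> L"
    using assms(1,2) unfolding smooth_submanifold_def by blast
  note T = tangent_space_chart[OF ch(2-5,7)]
  obtain l where l: "l \<in> L" "v = frechet_derivative \<psi> (at (\<phi> k)) l"
    using T(1)[of k] ch assms by auto
  have U: "open U" and V: "open V" "C_upto (Suc 0) V \<psi>" and c: "continuous_on U \<phi>"
    using ch(2-4) by (auto simp: smooth_on_open_def homeomorphism_def)
  have pk: "\<phi> k \<in> V" using ch(1,4) by (auto simp: homeomorphism_def)
  have "continuous_on V (\<lambda>y. frechet_derivative \<psi> (at y) l)" using V(2) by simp
  then have "isCont (\<lambda>y. frechet_derivative \<psi> (at y) l) (\<phi> k)"
    using V(1) pk continuous_on_eq_continuous_at by blast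
  moreover have "isCont \<phi> k" using c U ch(1) continuous_on_eq_continuous_at by blast
  ultimately have "(\<lambda>i. frechet_derivative \<psi> (at (\<phi> (q i))) l) \<longlonglongrightarrow> v"
    unfolding l by (rule isCont_tendsto_compose[OF _ isCont_tendsto_compose[OF _ q]])
  moreover have "\<forall>\<^sub>F i in sequentially. q i \<in> U" using q U ch(1) topological_tendstoD by blast
  then have "\<forall>\<^sub>F i in sequentially. frechet_derivative \<psi> (at (\<phi> (q i))) l \<in> tangent_space K (q i)"
    by (rule eventually_mono) (use T(1) l assms(4) in auto)
  ultimately show ?thesis using that by blast
qed

text \<open>The PL condition enters here: a knot is the homeomorphic image of a finite union of
  simplices. Compactness later provides limits of points of the lift and continuity of the
  heights.\<close>

lemma compact_pl_sphere:
  assumes "pl_homeomorphic_to_sphere n M"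
  shows "compact M"
proof -
  obtain T :: "'a set set" and t s where T: "simplicial_complex T" "homeomorphism (\<Union>T) M t s"
    using assms unfolding pl_homeomorphic_to_sphere_def smooth_triangulation_def by blast
  have "compact (\<Union>T)"
    using T(1) unfolding simplicial_complex_def by (intro compact_Union) (auto dest: simplex_imp_polytope polytope_imp_compact)
  then show ?thesis
    using T(2) by (metis compact_continuous_image homeomorphism_def)
qed

section \<open>An obstruction to lifting\<close>

text \<open>The map is given on the whole ambient space with a jointly continuous derivative, so
  that limits of tangent vectors can be taken without charts on the sphere. Injectivity is asked on
  the vectors orthogonal to \<open>x\<close>, the tangent vectors of the sphere.\<close>

locale spherical_immersion =
  fixes f :: "'a::euclidean_space \<Rightarrow> 'a" and D :: "'a \<Rightarrow> 'a \<Rightarrow> 'a"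
  assumes deriv: "(f has_derivative D x) (at x)"
    and D_tendsto: "\<And>x h a b. (x :: nat \<Rightarrow> 'a) \<longlonglongrightarrow> a \<Longrightarrow> h \<longlonglongrightarrow> b \<Longrightarrow> (\<lambda>i. D (x i) (h i)) \<longlonglongrightarrow> D a b"
    and immersive: "norm x = 1 \<Longrightarrow> x \<bullet> h = 0 \<Longrightarrow> D x h = 0 \<Longrightarrow> h = 0"
begin

text \<open>This is the tangent hyperplane at \<open>f x\<close> of the branch through
  \<open>x\<close>; it is indexed by \<open>x\<close> since several branches may pass through
  \<open>f x\<close>.\<close>

definition sheet :: "'a \<Rightarrow> 'a set" where
  "sheet x = D x ` {h. x \<bullet> h = 0}"

lemma linear_D: "linear (D x)"
  using deriv by (rule has_derivative_linear)

lemma f_tendsto: "x \<longlonglongrightarrow> a \<Longrightarrow> (\<lambda>i. f (x i)) \<longlonglongrightarrow> f a"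
  using isCont_tendsto_compose[OF has_derivative_continuous[OF deriv]] .

lemma inj_on_D: "norm x = 1 \<Longrightarrow> inj_on (D x) {h. x \<bullet> h = 0}"
  using immersive linear_D
  by (subst linear_inj_on_iff_eq_0) (auto simp: subspace_hyperplane)

lemma subspace_sheet: "subspace (sheet x)"
  unfolding sheet_def by (intro linear_subspace_image linear_D subspace_hyperplane)

lemma dim_sheet:
  assumes "norm x = 1"
  shows "dim (sheet x) = DIM('a) - 1"
proof -
  have "inj_on (D x) (span {h. x \<bullet> h = 0})"
    using inj_on_D[OF assms] by (simp add: subspace_hyperplane span_eq_iff[THEN iffD2])
  moreover have "x \<noteq> 0" using assms by auto
  ultimately show ?thesis
    unfolding sheet_def using dim_image_eq[OF linear_D] dim_hyperplane[of x] by simp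
qed

text \<open>A curve in the image may jump between branches, so it need not lift to the sphere.
  Still, preimages of \<open>c (s i)\<close> accumulate at some \<open>x\<close> over
  \<open>c 0\<close>, and the secants from \<open>x\<close> to them have a limit direction
  \<open>d\<close> tangent to the sphere. The chords of \<open>c\<close> are the images of these
  secants, hence \<open>v\<close> is a multiple of \<open>D x d\<close>.\<close>

lemma curve_tangent_to_sheet:
  assumes c: "(c has_vector_derivative v) (at (0::real))" and "e > 0"
    and img: "c ` {-e<..<e} \<subseteq> f ` sphere 0 1"
  obtains x where "norm x = 1" and "f x = c 0" and "v \<in> sheet x"
proof -
  define s where "s = (\<lambda>i. e / real (i + 2))"
  have s0: "s \<longlonglongrightarrow> 0"
    unfolding s_def using LIMSEQ_ignore_initial_segment[OF lim_const_over_n[of e], of 2] by simp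
  have spos: "s i > 0" for i using assms(2) by (simp add: s_def)
  have "s i \<in> {-e<..<e}" for i
  proof -
    have "s i < e / 1" unfolding s_def using assms(2) by (intro divide_strict_left_mono) auto
    then show ?thesis
      unfolding greaterThanLessThan_iff using spos[of i] assms(2) by linarith
  qed
  then have "\<exists>y. norm y = 1 \<and> f y = c (s i)" for i
  proof -
    have "c (s i) \<in> f ` sphere 0 1" using img \<open>s i \<in> {-e<..<e}\<close> by blast
    then show ?thesis by force
  qed
  then obtain y where y: "\<And>i. norm (y i) = 1" "\<And>i. f (y i) = c (s i)" by metis
  obtain x r where r: "norm x = 1" "strict_mono r" "(y \<circ> r) \<longlonglongrightarrow> x"
    using compact_sphere[of "0::'a" 1] y(1) unfolding compact_def
    by (metis (no_types, lifting) mem_sphere_0)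
  have sr0: "(\<lambda>i. s (r i)) \<longlonglongrightarrow> 0"
    using LIMSEQ_subseq_LIMSEQ[OF s0 r(2)] by (simp add: o_def)
  have q: "(\<lambda>i. (c (s (r i)) - c 0) /\<^sub>R s (r i)) \<longlonglongrightarrow> v"
    by (rule curve_limit[OF c spos sr0])
  have "isCont c 0" using c unfolding has_vector_derivative_def by (rule has_derivative_continuous)
  then have "(\<lambda>i. f (y (r i))) \<longlonglongrightarrow> c 0"
    unfolding y(2) using sr0 by (rule isCont_tendsto_compose)
  moreover have "(\<lambda>i. f (y (r i))) \<longlonglongrightarrow> f x"
    using f_tendsto r(3) by (simp add: o_def)
  ultimately have fx: "f x = c 0" by (metis LIMSEQ_unique)
  show thesis
  proof (cases "v = 0")
    case True
    then show ?thesis using that[OF r(1) fx] subspace_0[OF subspace_sheet] by simp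
  next
    case False
    have "\<forall>\<^sub>F i in sequentially. (c (s (r i)) - c 0) /\<^sub>R s (r i) \<noteq> 0"
      using tendsto_imp_eventually_ne[OF q False] .
    then have "\<forall>\<^sub>F i in sequentially. y (r i) - x \<noteq> 0"
      by (rule eventually_mono) (metis y(2) fx diff_self right_minus_eq scaleR_zero_right)
    then obtain N where N: "\<And>i. i \<ge> N \<Longrightarrow> y (r i) - x \<noteq> 0"
      unfolding eventually_sequentially by blast
    define h where "h i = y (r (i + N)) - x" for i
    have h: "h i \<noteq> 0" for i using N by (simp add: h_def)
    have h0: "h \<longlonglongrightarrow> 0"
      unfolding h_def using LIMSEQ_ignore_initial_segment[OF r(3), of N] by (simp add: o_def LIM_zero)
    have "h i /\<^sub>R norm (h i) \<in> sphere 0 1" for i using h by simp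
    then obtain d r' where d: "norm d = 1" "strict_mono r'" "((\<lambda>i. h i /\<^sub>R norm (h i)) \<circ> r') \<longlonglongrightarrow> d"
      using compact_sphere[of "0::'a" 1] unfolding compact_def by (metis (no_types, lifting) mem_sphere_0)
    have dl: "(\<lambda>i. h (r' i) /\<^sub>R norm (h (r' i))) \<longlonglongrightarrow> d" using d(3) by (simp add: o_def)
    have hr0: "(\<lambda>i. h (r' i)) \<longlonglongrightarrow> 0"
      using LIMSEQ_subseq_LIMSEQ[OF h0 d(2)] by (simp add: o_def)
    \<comment> \<open>Both \<open>x\<close> and \<open>x + h i\<close> are unit vectors; this makes
      the normalized secants orthogonal to \<open>x\<close> in the limit.\<close>
    have "x \<bullet> h i = - (norm (h i))\<^sup>2 / 2" for i
    proof -
      have "1 = (norm (x + h i))\<^sup>2" using y(1) by (simp add: h_def)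
      also have "\<dots> = 1 + 2 * (x \<bullet> h i) + (norm (h i))\<^sup>2"
        using r(1) by (simp add: power2_norm_eq_inner inner_add inner_commute norm_eq_1)
      finally show ?thesis by simp
    qed
    then have "x \<bullet> (h i /\<^sub>R norm (h i)) = - norm (h i) / 2" for i
      using h[of i] by (simp add: power2_eq_square field_simps)
    moreover have "(\<lambda>i. x \<bullet> (h (r' i) /\<^sub>R norm (h (r' i)))) \<longlonglongrightarrow> x \<bullet> d"
      by (intro tendsto_intros dl)
    ultimately have "(\<lambda>i. - norm (h (r' i)) / 2) \<longlonglongrightarrow> x \<bullet> d" by simp
    moreover have "(\<lambda>i. - norm (h (r' i)) / 2) \<longlonglongrightarrow> - norm (0::'a) / 2"
      by (intro tendsto_intros hr0) simp
    ultimately have xd: "x \<bullet> d = 0" using LIMSEQ_unique by fastforce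
    then have Dd: "D x d \<noteq> 0" using immersive[OF r(1), of d] d(1) by auto
    define \<Delta> where "\<Delta> i = f (x + h (r' i)) - f x" for i
    define \<sigma> where "\<sigma> i = s (r (r' i + N))" for i
    have \<sigma>: "\<sigma> i > 0" for i using spos by (simp add: \<sigma>_def)
    have lim1: "(\<lambda>i. \<Delta> i /\<^sub>R norm (h (r' i))) \<longlonglongrightarrow> D x d"
      unfolding \<Delta>_def by (rule directional_limit[OF deriv h hr0 dl])
    have lim2: "(\<lambda>i. \<Delta> i /\<^sub>R \<sigma> i) \<longlonglongrightarrow> v"
      using LIMSEQ_subseq_LIMSEQ[OF LIMSEQ_ignore_initial_segment[OF q, of N] d(2)]
      by (simp add: o_def \<Delta>_def \<sigma>_def h_def y(2) fx)
    have \<Delta>: "\<forall>\<^sub>F i in sequentially. \<Delta> i \<noteq> 0"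
      using tendsto_imp_eventually_ne[OF lim1 Dd] by (rule eventually_mono) auto
    \<comment> \<open>Passing between the two normalizations of \<open>\<Delta> i\<close> multiplies
      by a ratio of norms, which converges because \<open>D x d\<close> is nonzero.\<close>
    have "(\<lambda>i. (norm (\<Delta> i /\<^sub>R \<sigma> i) / norm (\<Delta> i /\<^sub>R norm (h (r' i)))) *\<^sub>R (\<Delta> i /\<^sub>R norm (h (r' i))))
        \<longlonglongrightarrow> (norm v / norm (D x d)) *\<^sub>R D x d"
      by (intro tendsto_intros lim1 lim2) (use Dd in simp)
    moreover have "\<forall>\<^sub>F i in sequentially.
        (norm (\<Delta> i /\<^sub>R \<sigma> i) / norm (\<Delta> i /\<^sub>R norm (h (r' i)))) *\<^sub>R (\<Delta> i /\<^sub>R norm (h (r' i))) = \<Delta> i /\<^sub>R \<sigma> i"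
      using \<Delta>
    proof (rule eventually_mono)
      fix i assume "\<Delta> i \<noteq> 0"
      then show "(norm (\<Delta> i /\<^sub>R \<sigma> i) / norm (\<Delta> i /\<^sub>R norm (h (r' i)))) *\<^sub>R (\<Delta> i /\<^sub>R norm (h (r' i))) = \<Delta> i /\<^sub>R \<sigma> i"
        using h[of "r' i"] \<sigma>[of i] by (simp add: field_simps)
    qed
    ultimately have "(\<lambda>i. \<Delta> i /\<^sub>R \<sigma> i) \<longlonglongrightarrow> (norm v / norm (D x d)) *\<^sub>R D x d"
      by (rule Lim_transform_eventually)
    then have "v = (norm v / norm (D x d)) *\<^sub>R D x d" using lim2 LIMSEQ_unique by blast
    also have "\<dots> = D x ((norm v / norm (D x d)) *\<^sub>R d)" using linear_D by (simp add: linear_scale)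
    finally have "v \<in> sheet x" unfolding sheet_def using xd by auto
    then show ?thesis using that[OF r(1) fx] by blast
  qed
qed

text \<open>Nothing bounds the preimages \<open>h i\<close> of \<open>u i\<close> in advance. So the
  pair of \<open>t i\<close> and \<open>t i *\<^sub>R h i\<close>, normalized to total size 1, is
  made to converge. If the limit of \<open>t\<close> were zero, the limit \<open>d\<close> would be
  a unit tangent vector killed by \<open>D a\<close>.\<close>

lemma sheet_limit:
  assumes "x \<longlonglongrightarrow> a" and "\<And>i. norm (x i) = 1" and u: "u \<longlonglongrightarrow> v"
    and mem: "\<forall>\<^sub>F i in sequentially. u i \<in> sheet (x i)"
  shows "v \<in> sheet a"
proof -
  have na: "norm a = 1"
    using tendsto_norm[OF assms(1)] assms(2) by (simp add: LIMSEQ_const_iff)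
  obtain N where "\<And>i. i \<ge> N \<Longrightarrow> u i \<in> sheet (x i)"
    using mem unfolding eventually_sequentially by blast
  then have "u (i + N) \<in> sheet (x (i + N))" for i by simp
  then have "\<exists>h. x (i + N) \<bullet> h = 0 \<and> u (i + N) = D (x (i + N)) h" for i
    unfolding sheet_def by (metis (mono_tags, lifting) imageE mem_Collect_eq)
  then obtain h where h: "\<And>i. x (i + N) \<bullet> h i = 0" "\<And>i. u (i + N) = D (x (i + N)) (h i)" by metis
  have xN: "(\<lambda>i. x (i + N)) \<longlonglongrightarrow> a" and uN: "(\<lambda>i. u (i + N)) \<longlonglongrightarrow> v"
    using assms(1) u by (auto intro: LIMSEQ_ignore_initial_segment)
  define t where "t i = inverse (1 + norm (h i))" for i
  have t: "t i > 0" "t i \<le> 1" "norm (t i *\<^sub>R h i) \<le> 1" "t i + norm (t i *\<^sub>R h i) = 1" for i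
    by (auto simp: t_def add_pos_nonneg inverse_le_1_iff divide_simps add_nonneg_eq_0_iff)
  have "(t i, t i *\<^sub>R h i) \<in> cball 0 1 \<times> cball 0 1" for i
    using t[of i] by simp
  moreover have "compact (cball (0::real) 1 \<times> cball (0::'a) 1)" by (intro compact_Times compact_cball)
  ultimately obtain l r where r: "strict_mono r" "((\<lambda>i. (t i, t i *\<^sub>R h i)) \<circ> r) \<longlonglongrightarrow> l"
    unfolding compact_def by (metis (no_types, lifting))
  obtain \<tau> d where l: "l = (\<tau>, d)" by (cases l)
  have tl: "(\<lambda>i. t (r i)) \<longlonglongrightarrow> \<tau>" and dl: "(\<lambda>i. t (r i) *\<^sub>R h (r i)) \<longlonglongrightarrow> d"
    using tendsto_fst[OF r(2)] tendsto_snd[OF r(2)] by (simp_all add: l o_def)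
  have xr: "(\<lambda>i. x (r i + N)) \<longlonglongrightarrow> a" and ur: "(\<lambda>i. u (r i + N)) \<longlonglongrightarrow> v"
    using LIMSEQ_subseq_LIMSEQ[OF xN r(1)] LIMSEQ_subseq_LIMSEQ[OF uN r(1)] by (simp_all add: o_def)
  have "(\<lambda>i. x (r i + N) \<bullet> (t (r i) *\<^sub>R h (r i))) \<longlonglongrightarrow> a \<bullet> d"
    by (intro tendsto_inner xr dl)
  then have ad: "a \<bullet> d = 0" using h(1) by (simp add: LIMSEQ_const_iff)
  have "(\<lambda>i. t (r i) *\<^sub>R u (r i + N)) \<longlonglongrightarrow> \<tau> *\<^sub>R v" by (intro tendsto_scaleR tl ur)
  moreover have "(\<lambda>i. D (x (r i + N)) (t (r i) *\<^sub>R h (r i))) \<longlonglongrightarrow> D a d" by (rule D_tendsto[OF xr dl])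
  ultimately have Dad: "D a d = \<tau> *\<^sub>R v"
    using linear_D LIMSEQ_unique by (simp add: linear_scale h(2))
  have "(\<lambda>i. t (r i) + norm (t (r i) *\<^sub>R h (r i))) \<longlonglongrightarrow> \<tau> + norm d" by (intro tendsto_intros tl dl)
  then have "\<tau> + norm d = 1" using t(4) by (simp add: LIMSEQ_const_iff)
  then have "\<tau> \<noteq> 0" using immersive[OF na ad] Dad by auto
  then have "v = D a (d /\<^sub>R \<tau>)" using Dad linear_D by (simp add: linear_scale)
  then show ?thesis unfolding sheet_def using ad by auto
qed

end

section \<open>Points of a lift over a given branch\<close>

locale lifted_immersion = spherical_immersion f D
  for f :: "'a::euclidean_space \<Rightarrow> 'a" and D +
  fixes K :: "('a \<times> real) set" and n :: nat
  assumes dim: "DIM('a) = n + 1"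
    and compact_K: "compact K" and submanifold: "smooth_submanifold n K"
    and transverse: "self_transverse_immersion K fst" and projection: "fst ` K = f ` sphere 0 1"
begin

text \<open>At a multiple point the tangent hyperplanes tell which point of the lift belongs to
  which branch. An inclusion is used since it passes to limits; \<open>over_eq\<close> improves it
  to an equality by dimension.\<close>

definition over :: "'a \<Rightarrow> 'a \<times> real \<Rightarrow> bool" where
  "over x k \<longleftrightarrow> k \<in> K \<and> fst k = f x \<and> fst ` tangent_space K k \<subseteq> sheet x"

lemma differential_fst: "v \<in> tangent_space K k \<Longrightarrow> differential K fst k v = fst v"
  by (rule differential_tangent[OF has_derivative_fst[OF has_derivative_ident]])

lemma projected_tangent_space:
  assumes "k \<in> K"
  shows "subspace (fst ` tangent_space K k)" and "dim (fst ` tangent_space K k) = n"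
proof -
  note T = tangent_space_submanifold[OF submanifold assms]
  have "inj_on (differential K fst k) (tangent_space K k)"
    using transverse assms unfolding self_transverse_immersion_def immersion_def by blast
  then have "inj_on fst (tangent_space K k)"
    using differential_fst by (simp cong: inj_on_cong)
  then show "dim (fst ` tangent_space K k) = n"
    using T dim_image_eq[OF linear_fst, of "tangent_space K k"] by (simp add: span_eq_iff[THEN iffD2])
  show "subspace (fst ` tangent_space K k)"
    by (rule linear_subspace_image[OF linear_fst T(1)])
qed

lemma over_eq: "norm x = 1 \<Longrightarrow> over x k \<Longrightarrow> fst ` tangent_space K k = sheet x"
  unfolding over_def
  by (intro subspace_dim_equal projected_tangent_space subspace_sheet)
    (auto simp: projected_tangent_space(2) dim_sheet dim)

text \<open>Transversality of \<open>fst\<close> at two distinct points, tested on \<open>v\<close>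
  at \<open>k\<close> and 0 at \<open>k'\<close>, writes any \<open>v\<close> as a difference of
  projected tangent vectors. If both lie in the same sheet, this hyperplane would be the whole
  space.\<close>

lemma over_unique:
  assumes "norm x = 1" and "over x k" and "over x k'"
  shows "k = k'"
proof (rule ccontr)
  assume ne: "k \<noteq> k'"
  have K: "k \<in> K" "k' \<in> K" "fst k = f x" "fst k' = f x" using assms by (auto simp: over_def)
  have "v \<in> sheet x" for v
  proof -
    have "\<exists>u t. \<forall>y\<in>{k, k'}. t y \<in> tangent_space K y \<and>
        (if y = k then v else 0) = u + differential K fst y (t y)"
      using transverse K unfolding self_transverse_immersion_def
      by (elim conjE allE[of _ "{k, k'}"] allE[of _ "\<lambda>y. if y = k then v else 0"]) auto
    then obtain u t where "t k \<in> tangent_space K k" "t k' \<in> tangent_space K k'"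
        "v = u + differential K fst k (t k)" "0 = u + differential K fst k' (t k')"
      using ne by auto
    then have "t k \<in> tangent_space K k" "t k' \<in> tangent_space K k'"
        "v = u + fst (t k)" "0 = u + fst (t k')"
      by (simp_all only: differential_fst)
    then have "fst (t k) \<in> sheet x" "fst (t k') \<in> sheet x" "v = fst (t k) - fst (t k')"
      using assms(2,3) unfolding over_def by (blast, blast, simp add: eq_neg_iff_add_eq_0)
    then show ?thesis using subspace_diff[OF subspace_sheet] by simp
  qed
  then have "sheet x = UNIV" by auto
  then show False using dim_sheet[OF assms(1)] dim by (simp add: dim_UNIV)
qed

text \<open>A tangent vector at \<open>k\<close> projects to the velocity of a curve in the image,
  so \<open>curve_tangent_to_sheet\<close> puts it into a sheet at \<open>f x\<close>, and there is
  just one.\<close>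

lemma over_single_point:
  assumes "norm x = 1" and single: "\<And>y. norm y = 1 \<Longrightarrow> f y = f x \<Longrightarrow> y = x"
  shows "\<exists>k. over x k"
proof -
  have "f x \<in> fst ` K" unfolding projection using assms(1) by simp
  then obtain k where k: "k \<in> K" "fst k = f x" by force
  have "fst v \<in> sheet x" if v: "v \<in> tangent_space K k" for v
  proof -
    obtain \<gamma> e where g: "(0::real) < e" "\<gamma> ` {-e<..<e} \<subseteq> K" "\<gamma> 0 = k"
        "(\<gamma> has_vector_derivative v) (at 0)"
      using v unfolding tangent_space_def by blast
    have c: "((\<lambda>t. fst (\<gamma> t)) has_vector_derivative fst v) (at 0)"
      using bounded_linear.has_vector_derivative[OF bounded_linear_fst g(4)] .
    have "(\<lambda>t. fst (\<gamma> t)) ` {-e<..<e} \<subseteq> f ` sphere 0 1"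
      using g(2) unfolding projection[symmetric] by auto
    from curve_tangent_to_sheet[OF c g(1) this] show ?thesis
      using single k g(3) by metis
  qed
  then show ?thesis using k unfolding over_def by blast
qed

text \<open>Tangent vectors at \<open>l\<close> are limits of tangent vectors at \<open>k i\<close>,
  whose projections lie in the sheets of \<open>x i\<close>; limits of these lie in the sheet of
  \<open>a\<close>.\<close>

lemma over_closed:
  assumes "x \<longlonglongrightarrow> a" and "\<And>i. norm (x i) = 1" and k: "k \<longlonglongrightarrow> l" and ov: "\<And>i. over (x i) (k i)"
  shows "over a l"
proof -
  have kK: "k i \<in> K" for i using ov unfolding over_def by blast
  have lK: "l \<in> K"
    using closed_sequentially[OF compact_imp_closed[OF compact_K] kK k] .
  have "(\<lambda>i. f (x i)) \<longlonglongrightarrow> fst l" using tendsto_fst[OF k] ov by (simp add: over_def)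
  then have "fst l = f a" using f_tendsto[OF assms(1)] LIMSEQ_unique by blast
  moreover have "fst v \<in> sheet a" if v: "v \<in> tangent_space K l" for v
  proof -
    obtain u where u: "u \<longlonglongrightarrow> v" "\<forall>\<^sub>F i in sequentially. u i \<in> tangent_space K (k i)"
      using tangent_space_lower_semicontinuous[OF submanifold lK v kK k] .
    have "\<forall>\<^sub>F i in sequentially. fst (u i) \<in> sheet (x i)"
      using u(2) by (rule eventually_mono) (use ov in \<open>auto simp: over_def\<close>)
    then show ?thesis using sheet_limit[OF assms(1,2) tendsto_fst[OF u(1)]] by blast
  qed
  ultimately show ?thesis using lK unfolding over_def by blast
qed

lemma over_limit:
  assumes "x \<longlonglongrightarrow> a" and "\<And>i. norm (x i) = 1" and "\<And>i. \<exists>k. over (x i) k"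
  shows "\<exists>k. over a k"
proof -
  obtain k where k: "\<And>i. over (x i) (k i)" using assms(3) by metis
  then have "\<forall>i. k i \<in> K" by (auto simp: over_def)
  then obtain l r where "strict_mono r" "(k \<circ> r) \<longlonglongrightarrow> l"
    using compact_K unfolding compact_def by blast
  then have "over a l"
    using over_closed[of "x \<circ> r" a "k \<circ> r" l] assms(1,2) k LIMSEQ_subseq_LIMSEQ[of x a r] by simp
  then show ?thesis by blast
qed

text \<open>Each point of the loop is a limit of points with a single preimage, so there is a unique
  point \<open>k t\<close> of the lift over its branch. The height difference of opposite parameters
  cannot vanish, as equal points would have equal sheets, but it changes sign after half a
  turn.\<close>

theorem no_sheet_exchange:
  assumes cont: "continuous_on UNIV \<gamma>" and sph: "\<And>t::real. norm (\<gamma> t) = 1"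
    and period: "\<And>t. \<gamma> (t + 2 * pi) = \<gamma> t" and double: "\<And>t. f (\<gamma> (t + pi)) = f (\<gamma> t)"
    and cross: "\<And>t. sheet (\<gamma> (t + pi)) \<noteq> sheet (\<gamma> t)"
    and approx: "\<And>t. \<exists>x. x \<longlonglongrightarrow> \<gamma> t \<and>
      (\<forall>i. norm (x i) = 1 \<and> (\<forall>y. norm y = 1 \<longrightarrow> f y = f (x i) \<longrightarrow> y = x i))"
  shows False
proof -
  have "\<exists>k. over (\<gamma> t) k" for t
  proof -
    obtain x where "x \<longlonglongrightarrow> \<gamma> t" "\<And>i. norm (x i) = 1"
        "\<And>i y. norm y = 1 \<Longrightarrow> f y = f (x i) \<Longrightarrow> y = x i"
      using approx[of t] by blast
    then show ?thesis using over_limit over_single_point by metis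
  qed
  then obtain k where k: "\<And>t. over (\<gamma> t) (k t)" by metis
  have kK: "k t \<in> K" for t using k by (auto simp: over_def)
  \<comment> \<open>Uniqueness and \<open>over_closed\<close> give a closed graph; a map with closed
    graph into a compact set is continuous.\<close>
  have "continuous_on UNIV k"
  proof -
    let ?G = "(\<lambda>t. (t, k t)) ` UNIV"
    have "closed ?G"
      unfolding closed_sequential_limits
    proof (intro allI impI, elim conjE)
      fix p l assume p: "\<forall>i. p i \<in> ?G" and lim: "p \<longlonglongrightarrow> l"
      have snd: "snd (p i) = k (fst (p i))" for i using p by (metis (no_types, lifting) fst_conv imageE snd_conv)
      have "(\<lambda>i. \<gamma> (fst (p i))) \<longlonglongrightarrow> \<gamma> (fst l)"
        using cont tendsto_fst[OF lim] by (auto simp: continuous_on_eq_continuous_at intro: isCont_tendsto_compose)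
      then have "over (\<gamma> (fst l)) (snd l)"
        by (rule over_closed[OF _ sph tendsto_snd[OF lim]]) (simp add: snd k)
      then have "snd l = k (fst l)" using over_unique sph k by blast
      then show "l \<in> ?G" by (metis prod.collapse rangeI)
    qed
    then have "closedin (top_of_set (UNIV \<times> K)) ?G"
      using kK by (intro closed_subset) auto
    then show ?thesis
      using continuous_closed_graph_eq[OF compact_K, of k UNIV] kK by auto
  qed
  then have hc: "continuous_on UNIV (\<lambda>t. snd (k t))" by (intro continuous_intros)
  define \<delta> where "\<delta> t = snd (k (t + pi)) - snd (k t)" for t
  have "\<delta> t \<noteq> 0" for t
  proof
    assume "\<delta> t = 0"
    then have "k (t + pi) = k t"
      using k double by (auto simp: \<delta>_def over_def prod_eq_iff)
    then have "sheet (\<gamma> (t + pi)) = sheet (\<gamma> t)" using over_eq[OF sph k] by metis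
    then show False using cross by blast
  qed
  moreover have "\<delta> pi = - \<delta> 0"
  proof -
    have "\<gamma> (2 * pi) = \<gamma> 0" using period[of 0] by simp
    then have "k (2 * pi) = k 0" using over_unique[OF sph k] k by metis
    then show ?thesis by (simp add: \<delta>_def)
  qed
  moreover have "continuous_on {0..pi} \<delta>"
    unfolding \<delta>_def
    by (intro continuous_intros continuous_on_compose2[OF hc] continuous_on_subset[OF hc]) auto
  ultimately show False
    using IVT'[of \<delta> 0 0 pi] IVT2'[of \<delta> pi 0 0] pi_ge_zero
    by (smt (verit))
qed

end

section \<open>An immersion with a loop of exchanged sheets\<close>

text \<open>Both monomials gain the factor e^(is) when \<open>z\<close> is turned by the angle s and
  \<open>w\<close> by 2s, which makes the construction symmetric along the Moebius band. The
  coefficients give \<open>quintic z w = z\<close> at moduli sqrt 3 / 2 and 1/2 with matching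
  phases, and they keep \<open>im_coeff\<close> within \<open>im_coeff_bounds\<close>.\<close>

definition quintic :: "complex \<Rightarrow> complex \<Rightarrow> complex" where
  "quintic z w = of_real (5/3) * z ^ 3 * cnj w + 2 * cnj z ^ 3 * w ^ 2"

text \<open>This is the real differential at \<open>(z, w)\<close> in the direction
  \<open>(u, v)\<close>.\<close>

definition quintic_deriv :: "complex \<Rightarrow> complex \<Rightarrow> complex \<Rightarrow> complex \<Rightarrow> complex" where
  "quintic_deriv z w u v =
     of_real (5/3) * (3 * z ^ 2 * u * cnj w + z ^ 3 * cnj v) +
     2 * (3 * cnj z ^ 2 * cnj u * w ^ 2 + 2 * cnj z ^ 3 * w * v)"

lemma quintic_polar:
  "quintic (\<omega> * \<xi>) (\<omega> ^ 2) =
     \<omega> * (of_real (5/3 * (cmod \<omega>) ^ 4) * \<xi> ^ 3 + of_real (2 * (cmod \<omega>) ^ 6) * cnj \<xi> ^ 3)"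
proof -
  have p: "of_real ((cmod \<omega>) ^ 4) = (\<omega> * cnj \<omega>) ^ 2" "of_real ((cmod \<omega>) ^ 6) = (\<omega> * cnj \<omega>) ^ 3"
    by (simp_all add: complex_norm_square[symmetric] power_mult[symmetric] flip: of_real_power)
  show ?thesis
    unfolding quintic_def of_real_mult p
    by (simp add: power_mult_distrib power2_eq_square power3_eq_cube algebra_simps)
qed

text \<open>The direction is the infinitesimal rotation of \<open>z\<close> at fixed
  \<open>w\<close>. It multiplies the cube of \<open>z\<close> by 3i and that of
  \<open>cnj z\<close> by -3i, whence the coefficients 5 and 6.\<close>

lemma quintic_deriv_polar:
  "quintic_deriv (\<omega> * \<xi>) (\<omega> ^ 2) (\<i> * (\<omega> * \<xi>)) 0 =
     \<i> * \<omega> * (of_real (5 * (cmod \<omega>) ^ 4) * \<xi> ^ 3 - of_real (6 * (cmod \<omega>) ^ 6) * cnj \<xi> ^ 3)"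
proof -
  have p: "of_real ((cmod \<omega>) ^ 4) = (\<omega> * cnj \<omega>) ^ 2" "of_real ((cmod \<omega>) ^ 6) = (\<omega> * cnj \<omega>) ^ 3"
    by (simp_all add: complex_norm_square[symmetric] power_mult[symmetric] flip: of_real_power)
  show ?thesis
    unfolding quintic_deriv_def of_real_mult p
    by (simp add: power_mult_distrib power2_eq_square power3_eq_cube algebra_simps)
qed

text \<open>
  In the coordinates \<open>z = \<omega> * Complex X Y\<close>, where \<open>\<omega>\<^sup>2 = w\<close>, the quintic acts on the two axes through
  the combinations below of its coefficients; here \<open>p\<close> is the modulus of \<open>w\<close>.
\<close>

definition re_coeff :: "real \<Rightarrow> real" where "re_coeff p = 5/3 * p ^ 2 + 2 * p ^ 3"
definition im_coeff :: "real \<Rightarrow> real" where "im_coeff p = 5/3 * p ^ 2 - 2 * p ^ 3"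

text \<open>Conjugation keeps the real part of a cube and negates the imaginary part, so the two
  coefficients add on one axis and subtract on the other.\<close>

lemma diff_quintic_polar:
  assumes "p = (cmod \<omega>) ^ 2"
  shows "\<omega> * Complex X Y - quintic (\<omega> * Complex X Y) (\<omega> ^ 2) =
    \<omega> * Complex (X * (1 - re_coeff p * (X^2 - 3 * Y^2))) (Y * (1 - im_coeff p * (3 * X^2 - Y^2)))"
proof -
  have p: "(cmod \<omega>) ^ 4 = p ^ 2" "(cmod \<omega>) ^ 6 = p ^ 3" using assms by (simp_all flip: power_mult)
  have "Complex X Y - (of_real (5/3 * p^2) * Complex X Y ^ 3 + of_real (2 * p^3) * cnj (Complex X Y) ^ 3)
      = Complex (X * (1 - re_coeff p * (X^2 - 3 * Y^2))) (Y * (1 - im_coeff p * (3 * X^2 - Y^2)))"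
    by (simp add: complex_eq_iff re_coeff_def im_coeff_def power2_eq_square power3_eq_cube algebra_simps)
  then show ?thesis
    unfolding quintic_polar p right_diff_distrib[of \<omega>, symmetric] by (rule arg_cong)
qed

lemma diff_quintic_deriv_polar:
  assumes "p = (cmod \<omega>) ^ 2" and "z = \<omega> * Complex X Y" and "w = \<omega> ^ 2"
  shows "\<i> * z - quintic_deriv z w (\<i> * z) 0 =
    \<omega> * Complex (- (Y * (1 - 3 * re_coeff p * (3 * X^2 - Y^2)))) (X * (1 - 3 * im_coeff p * (X^2 - 3 * Y^2)))"
proof -
  have p: "(cmod \<omega>) ^ 4 = p ^ 2" "(cmod \<omega>) ^ 6 = p ^ 3" using assms by (simp_all flip: power_mult)
  have "\<i> * (Complex X Y - (of_real (5 * p^2) * Complex X Y ^ 3 - of_real (6 * p^3) * cnj (Complex X Y) ^ 3))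
      = Complex (- (Y * (1 - 3 * re_coeff p * (3 * X^2 - Y^2)))) (X * (1 - 3 * im_coeff p * (X^2 - 3 * Y^2)))"
    by (simp add: complex_eq_iff re_coeff_def im_coeff_def power2_eq_square power3_eq_cube algebra_simps)
  moreover have "\<i> * (\<omega> * \<xi>) - \<i> * \<omega> * c = \<omega> * (\<i> * (\<xi> - c))" for \<xi> c
    by (simp add: algebra_simps)
  ultimately show ?thesis
    unfolding assms(2,3) quintic_deriv_polar p by (simp only:)
qed

section \<open>Monotonicity along the imaginary axis\<close>

text \<open>Here \<open>R\<close> is the squared modulus of \<open>z\<close>, and the product s is
  \<open>im_coeff p * (X^2 + Y^2)\<close>. The bounds are the thresholds for \<open>1 - 3 s\<close>
  and \<open>1 + 9 s\<close> to be positive, as needed in \<open>imaginary_part_inj\<close> and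
  \<open>axis_speed_pos\<close>.\<close>

lemma im_coeff_bounds_aux:
  fixes p R :: real
  assumes "0 \<le> p" "0 \<le> R" "R + p^2 \<le> 1"
  shows "R * (5/3 * p - 2 * p^2) < 1/3" and "- (1/9) < R * (5/3 * p - 2 * p^2)"
proof -
  have p1: "p \<le> 1" by (rule power2_le_imp_le) (use assms in auto)
  show "R * (5/3 * p - 2 * p^2) < 1/3"
  proof (cases "5/3 * p - 2 * p^2 \<le> 0")
    case True
    then show ?thesis using mult_nonneg_nonpos[OF assms(2) True] by linarith
  next
    case False
    then have "p * (5/3 - 2 * p) > 0" by (simp add: power2_eq_square algebra_simps)
    then have p56: "p < 5/6" using assms(1) by (auto simp: zero_less_mult_iff)
    have "R * (5/3 * p - 2 * p^2) \<le> (1 - p^2) * (5/3 * p - 2 * p^2)"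
      using False assms(3) by (intro mult_right_mono) auto
    also have "3 * \<dots> = 1 - ((1 - 2*p) * (1 - 3*p) + p^3 * (5 - 6*p))"
      by (simp add: power2_eq_square power3_eq_cube field_simps)
    finally have "3 * (R * (5/3 * p - 2 * p^2)) \<le> 1 - ((1 - 2*p) * (1 - 3*p) + p^3 * (5 - 6*p))"
      by simp
    \<comment> \<open>The first product is negative only between its roots 1/3 and 1/2; there it is
      at least -1/24, and the second summand is at least 2/27.\<close>
    moreover have "(1 - 2*p) * (1 - 3*p) + p^3 * (5 - 6*p) > 0"
    proof (cases "1/3 \<le> p \<and> p \<le> 1/2")
      case True
      have "(1/3)^3 * 2 \<le> p^3 * (5 - 6*p)"
        using True by (intro mult_mono power_mono) auto
      moreover have "(1 - 2*p) * (1 - 3*p) = 6 * (p - 5/12)^2 - 1/24"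
        by (simp add: power2_eq_square algebra_simps)
      ultimately show ?thesis by (simp add: power3_eq_cube) (use zero_le_power2[of "p - 5/12"] in linarith)
    next
      case False
      then have "(1 - 2*p) * (1 - 3*p) > 0" by (auto simp: zero_less_mult_iff)
      moreover have "p^3 * (5 - 6*p) \<ge> 0" using assms(1) p56 by simp
      ultimately show ?thesis by simp
    qed
    ultimately show ?thesis by linarith
  qed
  show "- (1/9) < R * (5/3 * p - 2 * p^2)"
  proof (cases "5/3 * p - 2 * p^2 \<ge> 0")
    case True
    then show ?thesis using mult_nonneg_nonneg[OF assms(2) True] by linarith
  next
    case False
    then have "p * (2 * p - 5/3) > 0" by (simp add: power2_eq_square algebra_simps)
    then have p56: "5/6 < p" using assms(1) by (auto simp: zero_less_mult_iff)
    have "R \<le> 1 - p^2" using assms(3) by simp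
    also have "\<dots> \<le> 1 - (5/6)^2" using p56 by (intro diff_left_mono power_mono) auto
    finally have "R \<le> 11/36" by (simp add: power2_eq_square)
    moreover have "2 * p^2 - 5/3 * p \<le> 1/3"
    proof -
      have "(p - 1) * (2 * p + 1/3) \<le> 0" using p1 assms(1) by (intro mult_nonpos_nonneg) auto
      then show ?thesis by (simp add: power2_eq_square field_simps)
    qed
    ultimately have "R * (2 * p^2 - 5/3 * p) \<le> 11/36 * (1/3)"
      using False assms(2) by (intro mult_mono) auto
    then show ?thesis by (simp add: algebra_simps)
  qed
qed

lemma im_coeff_bounds:
  assumes "0 \<le> p" and "p * (X^2 + Y^2) + p^2 \<le> 1"
  shows "im_coeff p * (X^2 + Y^2) < 1/3" and "- (1/9) < im_coeff p * (X^2 + Y^2)"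
proof -
  have "im_coeff p * (X^2 + Y^2) = p * (X^2 + Y^2) * (5/3 * p - 2 * p^2)"
    by (simp add: im_coeff_def power2_eq_square power3_eq_cube algebra_simps)
  moreover have "0 \<le> p * (X^2 + Y^2)" using assms(1) by simp
  ultimately show "im_coeff p * (X^2 + Y^2) < 1/3" and "- (1/9) < im_coeff p * (X^2 + Y^2)"
    using im_coeff_bounds_aux[OF assms(1) _ assms(2)] by (simp_all only:)
qed

text \<open>On the circle \<open>X^2 + Y^2 = \<rho>\<close> the imaginary component is a cubic in
  \<open>Y\<close> alone. Its difference quotient \<open>1 - 3 * (e * \<rho>) + 4 * (e * Q)\<close>
  is positive, since \<open>Q\<close> lies between 0 and \<open>3 * \<rho>\<close>.\<close>

lemma imaginary_part_inj:
  fixes X Y X' Y' :: real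
  assumes "0 \<le> p" and "p * (X^2 + Y^2) + p^2 \<le> 1" and r: "X^2 + Y^2 = X'^2 + Y'^2"
    and eq: "Y * (1 - im_coeff p * (3 * X^2 - Y^2)) = Y' * (1 - im_coeff p * (3 * X'^2 - Y'^2))"
  shows "Y = Y'"
proof -
  define e \<rho> Q where "e = im_coeff p" and "\<rho> = X^2 + Y^2" and "Q = Y^2 + Y * Y' + Y'^2"
  have X: "X^2 = \<rho> - Y^2" "X'^2 = \<rho> - Y'^2" using r by (auto simp: \<rho>_def)
  have e: "e * \<rho> < 1/3" "- (1/9) < e * \<rho>" using im_coeff_bounds[OF assms(1,2)] by (auto simp: e_def \<rho>_def)
  have "(Y - Y') * (1 - 3 * (e * \<rho>) + 4 * (e * Q)) = 0"
    using eq unfolding X e_def[symmetric] Q_def by (simp add: power2_eq_square algebra_simps)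
  moreover have "1 - 3 * (e * \<rho>) + 4 * (e * Q) > 0"
  proof (cases "e \<ge> 0")
    case True
    have "Q = (Y + Y'/2)^2 + 3/4 * Y'^2" by (simp add: Q_def power2_eq_square algebra_simps)
    then have "Q \<ge> 0" by simp
    then have "e * Q \<ge> 0" using True by simp
    then show ?thesis using e by linarith
  next
    case False
    have "2 * (Y * Y') \<le> Y^2 + Y'^2" using sum_squares_bound[of Y Y'] by simp
    moreover have "Y^2 \<le> \<rho>" by (simp add: \<rho>_def)
    moreover have "Y'^2 \<le> \<rho>" by (simp add: \<rho>_def r)
    ultimately have "Q \<le> 3 * \<rho>" unfolding Q_def by linarith
    then have "e * Q \<ge> e * (3 * \<rho>)" using False by (intro mult_left_mono_neg) auto
    then show ?thesis using e by linarith
  qed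
  ultimately show "Y = Y'" by simp
qed

lemma axis_speed_pos:
  fixes X Y :: real
  assumes "0 \<le> p" and "p * (X^2 + Y^2) + p^2 \<le> 1"
  shows "1 - 3 * im_coeff p * (X^2 - 3 * Y^2) > 0"
proof -
  note b = im_coeff_bounds[OF assms]
  show ?thesis
  proof (cases "im_coeff p \<ge> 0")
    case True
    then have "im_coeff p * (X^2 - 3 * Y^2) \<le> im_coeff p * (X^2 + Y^2)"
      by (intro mult_left_mono) (auto intro: order_trans[of _ 0])
    then show ?thesis using b unfolding mult.assoc by linarith
  next
    case False
    then have "im_coeff p * (- 3 * (X^2 + Y^2)) \<ge> im_coeff p * (X^2 - 3 * Y^2)"
      by (intro mult_left_mono_neg) auto
    moreover have "im_coeff p * (- 3 * (X^2 + Y^2)) = - 3 * (im_coeff p * (X^2 + Y^2))" by (simp only: mult_ac)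
    ultimately show ?thesis using b unfolding mult.assoc by linarith
  qed
qed

lemma norm_polar:
  assumes "p = (cmod \<omega>) ^ 2"
  shows "(cmod (\<omega> * Complex X Y))^2 = p * (X^2 + Y^2)"
  using assms by (simp add: norm_mult power_mult_distrib cmod_power2)

lemma polar_exists:
  assumes "w \<noteq> 0"
  obtains X Y where "z = csqrt w * Complex X Y"
proof -
  have "z = csqrt w * Complex (Re (z / csqrt w)) (Im (z / csqrt w))" using assms by simp
  then show thesis using that by blast
qed

lemma norm_csqrt_square: "(cmod (csqrt w))^2 = cmod w"
  by (metis norm_power power2_csqrt)

section \<open>Double points and rotational derivative of the perturbation\<close>

text \<open>Injectivity of the imaginary component gives \<open>Y = Y'\<close>, equal moduli then
  give \<open>X' = - X\<close>. The real component is odd in \<open>X\<close>, so it must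
  vanish.\<close>

lemma quintic_double_point:
  assumes n: "cmod z = cmod z'" and le: "(cmod z)^2 + (cmod w)^2 \<le> 1"
    and eq: "z - quintic z w = z' - quintic z' w" and ne: "z \<noteq> z'"
  obtains X Y where "w \<noteq> 0" and "z = csqrt w * Complex X Y" and "z' = csqrt w * Complex (- X) Y"
    and "X \<noteq> 0" and "re_coeff (cmod w) * (X^2 - 3 * Y^2) = 1"
proof -
  have w: "w \<noteq> 0" using eq ne by (auto simp: quintic_def)
  define \<omega> p where "\<omega> = csqrt w" and "p = cmod w"
  have \<omega>: "\<omega> \<noteq> 0" "\<omega>^2 = w" "p = (cmod \<omega>)^2" "p > 0"
    using w by (simp_all add: \<omega>_def p_def norm_csqrt_square)
  obtain X Y where z: "z = \<omega> * Complex X Y" using polar_exists[OF w] unfolding \<omega>_def by blast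
  obtain X' Y' where z': "z' = \<omega> * Complex X' Y'" using polar_exists[OF w] unfolding \<omega>_def by blast
  have "p * (X^2 + Y^2) = p * (X'^2 + Y'^2)"
    using n norm_polar[OF \<omega>(3)] unfolding z z' by metis
  then have r: "X^2 + Y^2 = X'^2 + Y'^2" using \<omega>(4) by simp
  have le': "p * (X^2 + Y^2) + p^2 \<le> 1"
    using le norm_polar[OF \<omega>(3)] unfolding z p_def[symmetric] by metis
  have "\<omega> * Complex (X * (1 - re_coeff p * (X^2 - 3 * Y^2))) (Y * (1 - im_coeff p * (3 * X^2 - Y^2))) =
      \<omega> * Complex (X' * (1 - re_coeff p * (X'^2 - 3 * Y'^2))) (Y' * (1 - im_coeff p * (3 * X'^2 - Y'^2)))"
    using eq unfolding z z' \<omega>(2)[symmetric] diff_quintic_polar[OF \<omega>(3)] .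
  then have re: "X * (1 - re_coeff p * (X^2 - 3 * Y^2)) = X' * (1 - re_coeff p * (X'^2 - 3 * Y'^2))"
      and im: "Y * (1 - im_coeff p * (3 * X^2 - Y^2)) = Y' * (1 - im_coeff p * (3 * X'^2 - Y'^2))"
    using \<omega>(1) by auto
  have Y: "Y = Y'" using imaginary_part_inj[OF _ le' r im] \<omega>(4) by simp
  then have "X^2 = X'^2" using r by simp
  moreover have "X \<noteq> X'" using ne Y unfolding z z' by auto
  ultimately have X': "X' = - X" and X: "X \<noteq> 0" by (auto simp: power2_eq_iff)
  have "X * (1 - re_coeff p * (X^2 - 3 * Y^2)) = 0" using re unfolding X' Y by simp
  then have "re_coeff p * (X^2 - 3 * Y^2) = 1" using X by simp
  then show thesis
    using that[of X Y] w z z' X Y X' unfolding \<omega>_def p_def by simp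
qed

text \<open>In polar form the second component forces \<open>X = 0\<close> by
  \<open>axis_speed_pos\<close>; the first then is \<open>Y\<close> times a nonzero factor, so
  \<open>Y = 0\<close> as well.\<close>

lemma quintic_rotation_immersive:
  assumes z: "z \<noteq> 0" and le: "(cmod z)^2 + (cmod w)^2 \<le> 1"
  shows "\<i> * z - quintic_deriv z w (\<i> * z) 0 \<noteq> 0"
proof (cases "w = 0")
  case True
  then show ?thesis using z by (simp add: quintic_deriv_def)
next
  case False
  define \<omega> p where "\<omega> = csqrt w" and "p = cmod w"
  have \<omega>: "\<omega> \<noteq> 0" "w = \<omega>^2" "p = (cmod \<omega>)^2" "p > 0"
    using False by (simp_all add: \<omega>_def p_def norm_csqrt_square)
  obtain X Y where zX: "z = \<omega> * Complex X Y" using polar_exists[OF False] unfolding \<omega>_def by blast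
  have le': "p * (X^2 + Y^2) + p^2 \<le> 1"
    using le norm_polar[OF \<omega>(3)] unfolding zX p_def[symmetric] by metis
  show ?thesis
  proof
    assume "\<i> * z - quintic_deriv z w (\<i> * z) 0 = 0"
    then have "Complex (- (Y * (1 - 3 * re_coeff p * (3 * X^2 - Y^2)))) (X * (1 - 3 * im_coeff p * (X^2 - 3 * Y^2))) = 0"
      unfolding diff_quintic_deriv_polar[OF \<omega>(3) zX \<omega>(2)] using \<omega>(1) by (metis mult_eq_0_iff)
    then have Y: "Y * (1 - 3 * re_coeff p * (3 * X^2 - Y^2)) = 0" and X: "X * (1 - 3 * im_coeff p * (X^2 - 3 * Y^2)) = 0"
      by (simp_all only: Complex_eq_0 neg_equal_0_iff_equal)
    have X0: "X = 0" using X axis_speed_pos[OF _ le'] \<omega>(4) by auto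
    have "re_coeff p > 0" using \<omega>(4) by (simp add: re_coeff_def add_pos_pos)
    then have "1 - 3 * re_coeff p * (3 * X^2 - Y^2) > 0" unfolding X0 by (simp add: add_pos_nonneg)
    then have "Y = 0" using Y by auto
    then show False using z zX X0 by (simp add: Complex_eq_0)
  qed
qed

text \<open>
  The last two hypotheses hold where two sheets are tangent to each other: \<open>R\<close> is the square of the
  modulus of \<open>z\<close>, and they say that \<open>h p = (1 - p\<^sup>2) (5/3 p + 2 p\<^sup>2)\<close> satisfies \<open>h p = 1\<close> and \<open>h' p = 0\<close>.
\<close>

lemma no_tangency:
  fixes p R :: real
  assumes p: "p > 0" and R: "R = 1 - p^2" and 1: "R * (5/3 * p + 2 * p^2) = 1"
    and 2: "2 * p^2 = R * (1 + 2 * R * p^2)"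
  shows False
proof -
  define P where "P = p^2"
  have cubic: "P + P^2 * (4 - 2 * P) = 1"
    using 2 unfolding R P_def[symmetric] by (simp add: power2_eq_square algebra_simps)
  have "R * (5/3 * p + 2 * p^2) > 0" using 1 by simp
  then have "R > 0" by (rule zero_less_mult_pos2) (use p in \<open>simp add: add_pos_pos\<close>)
  then have P: "0 < P" "P < 1" using p R by (auto simp: P_def)
  \<comment> \<open>The relevant root of the cubic is near 0.427 and is bracketed by
    \<open>lower\<close> and \<open>upper\<close>. There \<open>R * (5/3 * p + 2 * P)\<close> is at
    least 0.56 * 1.92, which exceeds 1.\<close>
  have lower: "P > 42/100"
  proof (rule ccontr)
    assume "\<not> ?thesis"
    then have c: "P \<le> 42/100" by simp
    have "P * P \<le> 42/100 * P" using c P by (intro mult_right_mono) auto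
    then have "P^2 * (4 - 2*P) \<le> 42/100 * P * (4 - 2*P)"
      using P by (intro mult_right_mono) (auto simp: power2_eq_square)
    also have "\<dots> = 168/100 * P - 84/100 * P^2" by (simp add: power2_eq_square field_simps)
    finally have "1 \<le> 268/100 * P - 84/100 * P^2" using cubic by simp
    moreover have "(P - 42/100)^2 \<ge> 0" by simp
    then have "P^2 \<ge> 84/100 * P - 1764/10000" by (simp add: power2_eq_square algebra_simps)
    ultimately show False using c by linarith
  qed
  have upper: "P < 44/100"
  proof (rule ccontr)
    assume "\<not> ?thesis"
    then have d: "P \<ge> 44/100" by simp
    have "P * P \<ge> 44/100 * P" using d P by (intro mult_right_mono) auto
    then have "P^2 * (4 - 2*P) \<ge> 44/100 * P * (4 - 2*P)"
      using P by (intro mult_right_mono) (auto simp: power2_eq_square)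
    also have "44/100 * P * (4 - 2*P) = 176/100 * P - 88/100 * P^2" by (simp add: power2_eq_square field_simps)
    finally have "1 \<ge> 276/100 * P - 88/100 * P^2" using cubic by simp
    moreover have "(P - 44/100) * (P - 1) \<le> 0" using d P by (intro mult_nonneg_nonpos) auto
    then have "P^2 \<le> 144/100 * P - 44/100" by (simp add: power2_eq_square field_simps)
    ultimately show False using d by linarith
  qed
  have "p \<ge> 648/1000"
  proof (rule ccontr)
    assume "\<not> ?thesis"
    then have "p^2 \<le> (648/1000)^2" using p by (intro power_mono) auto
    then show False using lower by (simp add: P_def power2_eq_square)
  qed
  then have "5/3 * p + 2 * P \<ge> 192/100" using lower by simp
  moreover have "R \<ge> 56/100" using upper R by (simp add: P_def)
  ultimately have "56/100 * (192/100) \<le> R * (5/3 * p + 2 * P)" by (intro mult_mono) auto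
  then show False using 1 by (simp add: P_def)
qed

lemma inner_complex_mult: "(\<omega> * a) \<bullet> (\<omega> * b) = (cmod \<omega>)^2 * (a \<bullet> b)" for a b :: complex
  unfolding inner_complex_def cmod_power2
  by (simp add: power2_eq_square algebra_simps)

section \<open>The immersion of the sphere and its self-transversality\<close>

locale two_complex_coordinates =
  fixes e1 e2 e3 e4 :: "'a::euclidean_space"
  assumes orthonormal: "e1 \<bullet> e1 = 1" "e2 \<bullet> e2 = 1" "e3 \<bullet> e3 = 1" "e4 \<bullet> e4 = 1"
    "e1 \<bullet> e2 = 0" "e1 \<bullet> e3 = 0" "e1 \<bullet> e4 = 0" "e2 \<bullet> e3 = 0" "e2 \<bullet> e4 = 0" "e3 \<bullet> e4 = 0"
begin

text \<open>\<open>Z\<close> and \<open>W\<close> are the orthogonal projections to two complex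
  lines, \<open>J\<close> and \<open>I\<close> the adjoint isometric inclusions. The remaining
  directions are left without coordinates, so the dimension is arbitrary.\<close>

definition Z :: "'a \<Rightarrow> complex" where "Z x = Complex (x \<bullet> e1) (x \<bullet> e2)"
definition W :: "'a \<Rightarrow> complex" where "W x = Complex (x \<bullet> e3) (x \<bullet> e4)"
definition J :: "complex \<Rightarrow> 'a" where "J c = Re c *\<^sub>R e1 + Im c *\<^sub>R e2"
definition I :: "complex \<Rightarrow> 'a" where "I c = Re c *\<^sub>R e3 + Im c *\<^sub>R e4"

lemma linear_Z: "linear Z" and linear_W: "linear W" and linear_J: "linear J" and linear_I: "linear I"
  by (auto intro!: linearI simp: Z_def W_def J_def I_def complex_eq_iff inner_add algebra_simps)

lemmas linear_coordinates [simp] =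
  linear_add[OF linear_Z] linear_diff[OF linear_Z] linear_scale[OF linear_Z] linear_neg[OF linear_Z]
  linear_add[OF linear_W] linear_diff[OF linear_W] linear_scale[OF linear_W] linear_neg[OF linear_W]

lemma coordinates [simp]: "Z (J c) = c" "W (J c) = 0" "Z (I c) = 0" "W (I c) = c"
  using orthonormal
  by (auto simp: Z_def W_def J_def I_def complex_eq_iff inner_add inner_commute)

lemma inner_J [simp]: "x \<bullet> J c = Z x \<bullet> c" "J c \<bullet> x = c \<bullet> Z x"
  and inner_I [simp]: "x \<bullet> I c = W x \<bullet> c" "I c \<bullet> x = c \<bullet> W x"
  by (auto simp: Z_def W_def J_def I_def inner_complex_def inner_add inner_commute)

text \<open>This is Bessel's inequality, from the squared length of the remainder.\<close>

lemma norm_coordinates: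
  assumes "norm x = 1"
  shows "(cmod (Z x))^2 + (cmod (W x))^2 \<le> 1"
proof -
  let ?r = "x - J (Z x) - I (W x)"
  have "?r \<bullet> ?r = x \<bullet> x - Z x \<bullet> Z x - W x \<bullet> W x"
    by (simp add: inner_diff)
  moreover have "?r \<bullet> ?r \<ge> 0" by simp
  ultimately show ?thesis using assms by (simp add: dot_square_norm)
qed

definition F :: "'a \<Rightarrow> 'a" where "F x = x - J (quintic (Z x) (W x))"

definition DF :: "'a \<Rightarrow> 'a \<Rightarrow> 'a" where
  "DF x h = h - J (quintic_deriv (Z x) (W x) (Z h) (W h))"

lemma Z_F: "Z (F x) = Z x - quintic (Z x) (W x)" and W_F: "W (F x) = W x"
  by (simp_all add: F_def)

lemma bounded_linear_coordinates:
  "bounded_linear Z" "bounded_linear W" "bounded_linear J" "bounded_linear I"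
  using linear_Z linear_W linear_J linear_I by (simp_all add: linear_conv_bounded_linear)

lemma F_derivative: "(F has_derivative DF x) (at x)"
proof -
  note [derivative_intros] =
    bounded_linear.has_derivative[OF bounded_linear_coordinates(1)]
    bounded_linear.has_derivative[OF bounded_linear_coordinates(2)]
    bounded_linear.has_derivative[OF bounded_linear_coordinates(3)]
    bounded_linear.has_derivative[OF bounded_linear_cnj]
  show ?thesis
    unfolding F_def[abs_def] DF_def[abs_def] quintic_def quintic_deriv_def
    by (auto intro!: derivative_eq_intros arg_cong[where f = J] simp: fun_eq_iff
        power2_eq_square power3_eq_cube algebra_simps)
qed

lemma F_smooth: "C_upto k UNIV F"
proof -
  have Z: "C_upto k UNIV Z" and W: "C_upto k UNIV W"
    using bounded_linear_coordinates by (simp_all add: C_upto_bounded_linear)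
  have cZ: "C_upto k UNIV (\<lambda>x. cnj (Z x))" and cW: "C_upto k UNIV (\<lambda>x. cnj (W x))"
    using Z W by (simp_all add: C_upto_compose_linear[OF open_UNIV bounded_linear_cnj])
  have "C_upto k UNIV (\<lambda>x. quintic (Z x) (W x))"
    unfolding quintic_def
    by (intro C_upto_add C_upto_mult C_upto_power C_upto_const open_UNIV Z W cZ cW)
  then have "C_upto k UNIV (\<lambda>x. - J (quintic (Z x) (W x)))"
    using C_upto_compose_linear[OF open_UNIV bounded_linear_minus[OF bounded_linear_coordinates(3)]] by blast
  then have "C_upto k UNIV (\<lambda>x. x + - J (quintic (Z x) (W x)))"
    by (rule C_upto_add[OF open_UNIV C_upto_bounded_linear[OF open_UNIV bounded_linear_ident]])
  then show ?thesis by (simp add: F_def[abs_def])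
qed

text \<open>As \<open>DF\<close> changes \<open>h\<close> only by a vector in the image of
  \<open>J\<close>, a kernel vector lies there, and \<open>W h = 0\<close>. Orthogonality to
  \<open>x\<close> makes \<open>Z h\<close> a multiple of \<open>\<i> * Z x\<close>, so
  \<open>quintic_rotation_immersive\<close> applies.\<close>

lemma F_immersive:
  assumes x: "norm x = 1" and xh: "x \<bullet> h = 0" and D0: "DF x h = 0"
  shows "h = 0"
proof -
  let ?z = "Z x" and ?w = "W x" and ?u = "Z h"
  have h: "h = J (quintic_deriv ?z ?w ?u (W h))" using D0 by (simp add: DF_def)
  have W0: "W h = 0" by (subst h) simp
  have u: "?u = quintic_deriv ?z ?w ?u 0" using h W0 by (metis coordinates(1))
  have hJ: "h = J ?u" using h u W0 by simp
  have zu: "?z \<bullet> ?u = 0" using xh hJ by (metis inner_J(1))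
  have "?u = 0"
  proof (cases "?z = 0")
    case True
    then show ?thesis using u by (simp add: quintic_deriv_def)
  next
    case False
    define m t where "m = Im (cnj ?z * ?u)" and "t = m / (cmod ?z)^2"
    have "Re (cnj ?z * ?u) = 0" using zu by (simp add: inner_complex_def)
    then have "cnj ?z * ?u = \<i> * of_real m" by (simp add: complex_eq_iff m_def)
    also have "m = t * (cmod ?z)^2" using False by (simp add: t_def)
    also have "\<i> * of_real (t * (cmod ?z)^2) = cnj ?z * (of_real t * (\<i> * ?z))"
      unfolding of_real_mult complex_norm_square by (simp add: mult_ac)
    finally have ut: "?u = of_real t * (\<i> * ?z)" using False by simp
    have "quintic_deriv ?z ?w (of_real t * (\<i> * ?z)) 0 = of_real t * quintic_deriv ?z ?w (\<i> * ?z) 0"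
      by (simp add: quintic_deriv_def algebra_simps)
    then have "of_real t * (\<i> * ?z - quintic_deriv ?z ?w (\<i> * ?z) 0) = 0"
      using u ut by (simp add: right_diff_distrib)
    then have "t = 0" using quintic_rotation_immersive[OF False norm_coordinates[OF x]] by simp
    then show ?thesis using ut by simp
  qed
  then show ?thesis using hJ linear_0[OF linear_J] by simp
qed

sublocale spherical_immersion F DF
proof
  show "(F has_derivative DF x) (at x)" for x by (rule F_derivative)
  show "h = 0" if "norm x = 1" "x \<bullet> h = 0" "DF x h = 0" for x h using F_immersive that .
  fix x h :: "nat \<Rightarrow> 'a" and a b assume lim: "x \<longlonglongrightarrow> a" "h \<longlonglongrightarrow> b"
  note [tendsto_intros] =
    bounded_linear.tendsto[OF bounded_linear_coordinates(1)]
    bounded_linear.tendsto[OF bounded_linear_coordinates(2)]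
    bounded_linear.tendsto[OF bounded_linear_coordinates(3)]
  show "(\<lambda>i. DF (x i) (h i)) \<longlonglongrightarrow> DF a b"
    unfolding DF_def quintic_deriv_def by (intro tendsto_intros lim)
qed

text \<open>\<open>F\<close> moves only the \<open>Z\<close> coordinate, so two preimages agree in
  all others; unit length then gives their \<open>Z\<close> coordinates equal moduli.\<close>

lemma F_double_point:
  assumes x: "norm x = 1" "norm x' = 1" and eq: "F x = F x'" and ne: "x \<noteq> x'"
  obtains X Y where "x' = x + J (Z x' - Z x)" and "W x' = W x" and "W x \<noteq> 0"
    and "Z x = csqrt (W x) * Complex X Y" and "Z x' = csqrt (W x) * Complex (- X) Y"
    and "X \<noteq> 0" and "re_coeff (cmod (W x)) * (X^2 - 3 * Y^2) = 1"
proof -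
  have W: "W x' = W x" using W_F eq by metis
  have Z: "Z x - quintic (Z x) (W x) = Z x' - quintic (Z x') (W x)" using Z_F eq W by metis
  have "x' - x = J (quintic (Z x') (W x) - quintic (Z x) (W x))"
    using eq by (simp add: F_def W linear_diff[OF linear_J] algebra_simps)
  moreover have "quintic (Z x') (W x) - quintic (Z x) (W x) = Z x' - Z x"
    using Z by (simp add: algebra_simps)
  ultimately have x': "x' = x + J (Z x' - Z x)" by (metis add.commute diff_add_cancel)
  have "x' \<bullet> x' = x \<bullet> x + (Z x' \<bullet> Z x' - Z x \<bullet> Z x)"
    by (subst (1 2) x') (simp add: inner_add inner_diff inner_commute)
  then have "cmod (Z x) = cmod (Z x')" using x by (simp add: dot_square_norm)
  moreover have "Z x \<noteq> Z x'" using x' ne linear_0[OF linear_J] by auto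
  ultimately show thesis
    using quintic_double_point[OF _ norm_coordinates[OF x(1)] Z] that x' W by metis
qed

text \<open>Let \<open>\<nu>\<close> be normal to both sheets, with \<open>Z\<close> part
  \<open>\<eta>\<close> of polar coordinates \<open>A\<close>, \<open>B\<close>. Rotating
  \<open>Z\<close> shows \<open>B = 0\<close>. If \<open>A = 0\<close>, then \<open>\<nu>\<close> is
  a multiple of \<open>x\<close>, hence 0. Otherwise \<open>Y = 0\<close>, and further test vectors
  yield the equations excluded by \<open>no_tangency\<close>.\<close>

lemma sheets_cross:
  assumes x: "norm x = 1" "norm x' = 1" and eq: "F x = F x'" and ne: "x \<noteq> x'"
    and \<nu>: "\<And>v. v \<in> sheet x \<Longrightarrow> \<nu> \<bullet> v = 0" "\<And>v. v \<in> sheet x' \<Longrightarrow> \<nu> \<bullet> v = 0"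
  shows "\<nu> = 0"
proof -
  obtain X Y where x': "x' = x + J (Z x' - Z x)" and W': "W x' = W x" and w0: "W x \<noteq> 0"
    and z: "Z x = csqrt (W x) * Complex X Y" and z': "Z x' = csqrt (W x) * Complex (- X) Y"
    and X: "X \<noteq> 0" and S1: "re_coeff (cmod (W x)) * (X^2 - 3 * Y^2) = 1"
    using F_double_point[OF x eq ne] by metis
  define \<omega> p where "\<omega> = csqrt (W x)" and "p = cmod (W x)"
  have \<omega>: "\<omega> \<noteq> 0" "W x = \<omega>^2" "p = (cmod \<omega>)^2" "p > 0"
    using w0 by (simp_all add: \<omega>_def p_def norm_csqrt_square)
  note z = z[folded \<omega>_def] and z' = z'[folded \<omega>_def] and S1 = S1[folded p_def]
  define \<eta> where "\<eta> = Z \<nu>"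
  have \<nu>D: "\<nu> \<bullet> h = \<eta> \<bullet> quintic_deriv (Z x) (W x) (Z h) (W h)" if "x \<bullet> h = 0" for h
    using \<nu>(1)[of "DF x h"] that by (auto simp: sheet_def DF_def inner_diff \<eta>_def)
  have \<nu>D': "\<nu> \<bullet> h = \<eta> \<bullet> quintic_deriv (Z x') (W x) (Z h) (W h)" if "x' \<bullet> h = 0" for h
    using \<nu>(2)[of "DF x' h"] that by (auto simp: sheet_def DF_def inner_diff \<eta>_def W')
  obtain A B where AB: "\<eta> = \<omega> * Complex A B" using polar_exists[OF w0] unfolding \<omega>_def by blast
  have le: "p * (X^2 + Y^2) + p^2 \<le> 1"
    using norm_coordinates[OF x(1)] norm_polar[OF \<omega>(3)] unfolding z p_def[symmetric] by metis
  define M N where "M = X * (1 - 3 * im_coeff p * (X^2 - 3 * Y^2))" and "N = Y * (1 - 3 * re_coeff p * (3 * X^2 - Y^2))"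
  have perp: "c \<bullet> (\<i> * c) = 0" for c by (simp add: inner_complex_def)
  \<comment> \<open>The vector \<open>J (\<i> * Z x)\<close> is tangent to the sphere at
    \<open>x\<close>; its analogue at \<open>x'\<close> has the opposite sign of \<open>X\<close>,
    which gives the second equation in \<open>M\<close> and \<open>N\<close>.\<close>
  have "\<eta> \<bullet> (\<i> * Z x - quintic_deriv (Z x) (W x) (\<i> * Z x) 0) = 0"
    using \<nu>D[of "J (\<i> * Z x)"] perp by (simp add: inner_diff \<eta>_def)
  then have 1: "- A * N + B * M = 0"
    unfolding diff_quintic_deriv_polar[OF \<omega>(3) z \<omega>(2)] AB inner_complex_mult
    using \<omega>(1) by (simp add: inner_complex_def M_def N_def)
  have "\<eta> \<bullet> (\<i> * Z x' - quintic_deriv (Z x') (W x) (\<i> * Z x') 0) = 0"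
    using \<nu>D'[of "J (\<i> * Z x')"] perp by (simp add: inner_diff \<eta>_def)
  then have 2: "- A * N - B * M = 0"
    unfolding diff_quintic_deriv_polar[OF \<omega>(3) z' \<omega>(2)] AB inner_complex_mult
    using \<omega>(1) by (simp add: inner_complex_def M_def N_def)
  have "M \<noteq> 0" using X axis_speed_pos[OF _ le] \<omega>(4) by (simp add: M_def)
  then have B: "B = 0" and AN: "A * N = 0" using 1 2 by auto
  have "Z x \<noteq> 0" using z \<omega>(1) X by (simp add: Complex_eq_0)
  show ?thesis
  proof (cases "A = 0")
    case True
    then have \<eta>0: "\<eta> = 0" using AB B by (simp add: Complex_eq_0)
    define c where "c = \<nu> \<bullet> x"
    have xx: "x \<bullet> x = 1" using x by (simp add: dot_square_norm)
    have orth: "x \<bullet> (\<nu> - c *\<^sub>R x) = 0" using xx by (simp add: c_def inner_diff inner_commute)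
    have "(\<nu> - c *\<^sub>R x) \<bullet> (\<nu> - c *\<^sub>R x) = \<nu> \<bullet> (\<nu> - c *\<^sub>R x) - c * (x \<bullet> (\<nu> - c *\<^sub>R x))"
      by (simp add: inner_diff_left)
    also have "\<dots> = 0" using \<nu>D[OF orth] orth \<eta>0 by simp
    finally have \<nu>: "\<nu> = c *\<^sub>R x" by simp
    then have "c *\<^sub>R Z x = 0" using \<eta>0 \<eta>_def by (metis linear_coordinates(3))
    then show ?thesis using \<nu> \<open>Z x \<noteq> 0\<close> by simp
  next
    case A: False
    have "N = 0" using AN A by simp
    \<comment> \<open>If \<open>Y\<close> were nonzero, \<open>N = 0\<close> would make
      \<open>re_coeff p * (3 * X^2 - Y^2)\<close> equal to 1/3, but by \<open>S1\<close> it is at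
      least 1.\<close>
    have Y: "Y = 0"
    proof (rule ccontr)
      assume "Y \<noteq> 0"
      then have "3 * (re_coeff p * (3 * X^2 - Y^2)) = 1" using \<open>N = 0\<close> by (simp add: N_def)
      moreover have "re_coeff p * (3 * X^2 - Y^2) = re_coeff p * (X^2 - 3 * Y^2) + 2 * (re_coeff p * (X^2 + Y^2))"
        by (simp add: algebra_simps)
      moreover have "re_coeff p * (X^2 + Y^2) \<ge> 0" using \<omega>(4) by (simp add: re_coeff_def)
      ultimately show False using S1 by simp
    qed
    have S1: "re_coeff p * X^2 = 1" using S1 Y by simp
    have zX: "Z x = of_real X * \<omega>" and zX': "Z x' = - Z x"
      using z z' Y by (simp_all add: complex_eq_iff)
    have \<eta>A: "\<eta> = of_real A * \<omega>" using AB B by (simp add: complex_eq_iff)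
    have \<omega>\<omega>: "(of_real a * \<omega>) \<bullet> (of_real b * \<omega>) = a * b * p" for a b :: real
      unfolding \<omega>(3) cmod_power2 inner_complex_def by (simp add: power2_eq_square algebra_simps)
    \<comment> \<open>Since \<open>Z x' = - Z x\<close>, negating the \<open>Z\<close> part carries
      tangent vectors at \<open>x\<close> to tangent vectors at \<open>x'\<close>. Comparing the two
      normality conditions isolates the terms with \<open>\<eta>\<close>.\<close>
    have main: "\<eta> \<bullet> (Z h - quintic_deriv (Z x) (W x) (Z h) (W h)) = 0" if h: "x \<bullet> h = 0" for h
    proof -
      let ?h = "h - J (2 * Z h)"
      have "x' \<bullet> ?h = 0"
        by (subst x') (use h in \<open>simp add: zX' inner_add inner_diff inner_complex_def algebra_simps\<close>)
      moreover have "quintic_deriv (- Z x) (W x) (- Z h) (W h) = - quintic_deriv (Z x) (W x) (Z h) (W h)"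
        by (simp add: quintic_deriv_def field_simps)
      ultimately have "\<nu> \<bullet> ?h = - (\<eta> \<bullet> quintic_deriv (Z x) (W x) (Z h) (W h))"
        using \<nu>D'[of ?h] zX' by simp
      moreover have "\<nu> \<bullet> ?h = \<nu> \<bullet> h - 2 * (\<eta> \<bullet> Z h)"
        by (simp add: inner_diff \<eta>_def inner_complex_def algebra_simps)
      ultimately show ?thesis using \<nu>D[OF h] by (simp add: inner_diff)
    qed
    define R where "R = (cmod (Z x))^2"
    have RX: "R = p * X^2" using norm_polar[OF \<omega>(3), of X Y] z Y unfolding R_def by simp
    have zz: "Z x \<bullet> Z x = R" and ww: "W x \<bullet> W x = p^2"
      by (simp_all add: R_def p_def dot_square_norm)
    have xx: "x \<bullet> x = 1" using x by (simp add: dot_square_norm)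
    have quint: "quintic (Z x) (W x) = Z x"
    proof -
      have "Z x - quintic (Z x) (W x) = 0"
        using diff_quintic_polar[OF \<omega>(3), of X Y] z \<omega>(2) Y S1 by (simp add: Complex_eq_0)
      then show ?thesis by simp
    qed
    \<comment> \<open>Euler's relation, the quintic being homogeneous of degree 3 in
      \<open>z\<close>.\<close>
    have dz: "quintic_deriv (Z x) (W x) (Z x) 0 = 3 * Z x"
    proof -
      have "quintic_deriv (Z x) (W x) (Z x) 0 = 3 * quintic (Z x) (W x)"
        by (simp add: quintic_deriv_def quintic_def power2_eq_square power3_eq_cube algebra_simps)
      then show ?thesis using quint by simp
    qed
    have hom: "quintic_deriv z w (a *\<^sub>R u) (b *\<^sub>R v) = a *\<^sub>R quintic_deriv z w u 0 + b *\<^sub>R quintic_deriv z w 0 v"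
      for z w u v a b by (simp add: quintic_deriv_def scaleR_conv_of_real algebra_simps)
    have \<kappa>: "1 - R - p^2 = 0"
    proof -
      define \<kappa> where "\<kappa> = 1 - R - p^2"
      \<comment> \<open>\<open>\<kappa>\<close> is the squared length of the part of
        \<open>x\<close> outside both complex lines. The test vector moves along that part and
        compensates in \<open>z\<close>.\<close>
      let ?h = "R *\<^sub>R (x - J (Z x) - I (W x)) - \<kappa> *\<^sub>R J (Z x)"
      have "x \<bullet> ?h = 0"
        by (simp add: inner_diff xx zz ww \<kappa>_def)
      moreover have "Z ?h = (- \<kappa>) *\<^sub>R Z x" "W ?h = 0 *\<^sub>R W x" by simp_all
      ultimately have "\<eta> \<bullet> ((- \<kappa>) *\<^sub>R Z x - (- \<kappa>) *\<^sub>R (3 * Z x)) = 0"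
        using main[of ?h] hom[of "Z x" "W x" "- \<kappa>" "Z x" 0 "W x"] dz by simp
      then have "2 * \<kappa> * (\<eta> \<bullet> Z x) = 0" by (simp add: inner_diff inner_complex_def algebra_simps)
      then show ?thesis unfolding \<eta>A zX \<omega>\<omega> using A X \<omega>(4) by (simp add: \<kappa>_def)
    qed
    \<comment> \<open>Radial scaling of \<open>w\<close> weights the monomials by their degrees 1
      and 2 in \<open>w\<close>, so the coefficient 2 becomes 4.\<close>
    have dw: "quintic_deriv (Z x) (W x) 0 (W x) = of_real ((5/3 * p^2 + 4 * p^3) * X^3) * \<omega>"
    proof -
      have pp: "of_real p = \<omega> * cnj \<omega>" using \<omega>(3) by (simp add: complex_norm_square[symmetric])
      show ?thesis
        unfolding quintic_deriv_def zX \<omega>(2) of_real_mult of_real_add of_real_power pp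
        by (simp add: power2_eq_square power3_eq_cube algebra_simps)
    qed
    have "2 * p^2 * X = R * ((5/3 * p^2 + 4 * p^3) * X^3)"
    proof -
      \<comment> \<open>This tangent vector trades the modulus of \<open>z\<close> for that of
        \<open>w\<close>; it yields the second equation of \<open>no_tangency\<close>.\<close>
      let ?h = "R *\<^sub>R I (W x) - p^2 *\<^sub>R J (Z x)"
      have "x \<bullet> ?h = 0" by (simp add: inner_diff zz ww)
      moreover have "Z ?h = (-(p^2)) *\<^sub>R Z x" "W ?h = R *\<^sub>R W x" by simp_all
      ultimately have "\<eta> \<bullet> ((-(p^2)) *\<^sub>R Z x - ((-(p^2)) *\<^sub>R (3 * Z x) + R *\<^sub>R (of_real ((5/3 * p^2 + 4 * p^3) * X^3) * \<omega>))) = 0"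
        using main[of ?h] hom[of "Z x" "W x" "-(p^2)" "Z x" R "W x"] dz dw by simp
      moreover have "(-(p^2)) *\<^sub>R Z x - ((-(p^2)) *\<^sub>R (3 * Z x) + R *\<^sub>R (of_real ((5/3 * p^2 + 4 * p^3) * X^3) * \<omega>))
          = of_real (2 * p^2 * X - R * ((5/3 * p^2 + 4 * p^3) * X^3)) * \<omega>"
        unfolding zX by (simp add: scaleR_conv_of_real algebra_simps)
      ultimately have "\<eta> \<bullet> (of_real (2 * p^2 * X - R * ((5/3 * p^2 + 4 * p^3) * X^3)) * \<omega>) = 0"
        by (simp only:)
      then show ?thesis unfolding \<eta>A \<omega>\<omega> using A \<omega>(4) by simp
    qed
    then have "2 * p^2 = R * ((5/3 * p^2 + 4 * p^3) * X^2)"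
      using X by (simp add: power3_eq_cube power2_eq_square)
    also have "(5/3 * p^2 + 4 * p^3) * X^2 = re_coeff p * X^2 + 2 * (p * X^2) * p^2"
      by (simp add: re_coeff_def power2_eq_square power3_eq_cube algebra_simps)
    finally have "2 * p^2 = R * (1 + 2 * R * p^2)" unfolding S1 RX .
    moreover have "R * (5/3 * p + 2 * p^2) = re_coeff p * X^2"
      unfolding RX re_coeff_def by (simp add: power2_eq_square power3_eq_cube algebra_simps)
    ultimately show ?thesis using no_tangency[OF \<omega>(4), of R] \<kappa> S1 by simp
  qed
qed


lemma sheet_sum:
  assumes "norm x = 1" "norm x' = 1" and "F x = F x'" and "x \<noteq> x'"
  obtains a b where "a \<in> sheet x" and "b \<in> sheet x'" and "v = a + b"
proof -
  let ?V = "{a + b |a b. a \<in> sheet x \<and> b \<in> sheet x'}"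
  have V: "subspace ?V" by (intro subspace_sums subspace_sheet)
  have sub: "sheet x \<subseteq> ?V" "sheet x' \<subseteq> ?V"
    using subspace_0[OF subspace_sheet, of x] subspace_0[OF subspace_sheet, of x'] by force+
  have "dim ?V = DIM('a)"
  proof (rule ccontr)
    assume "dim ?V \<noteq> DIM('a)"
    then have "dim ?V < DIM('a)" using dim_subset_UNIV[of ?V] by linarith
    then obtain \<nu> where \<nu>: "\<nu> \<noteq> 0" "\<And>y. y \<in> span ?V \<Longrightarrow> orthogonal \<nu> y"
      by (rule orthogonal_to_subspace_exists) blast
    have "\<nu> \<bullet> y = 0" if "y \<in> ?V" for y
      using \<nu>(2)[OF span_base[OF that]] by (simp only: orthogonal_def)
    then have "\<nu> = 0" using sub by (intro sheets_cross[OF assms]) blast+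
    then show False using \<nu>(1) by contradiction
  qed
  then have "span ?V = UNIV" by (simp only: dim_eq_full)
  then have "?V = UNIV" unfolding span_eq_iff[THEN iffD2, OF V] .
  then show thesis using that by blast
qed

lemma sheets_differ:
  assumes "norm x = 1" "norm x' = 1" and "F x = F x'" and "x \<noteq> x'"
  shows "sheet x' \<noteq> sheet x"
proof
  assume eq: "sheet x' = sheet x"
  have "v \<in> sheet x" for v
  proof -
    obtain a b where "a \<in> sheet x" "b \<in> sheet x" "v = a + b"
      using sheet_sum[OF assms, of v] unfolding eq by blast
    then show ?thesis using subspace_add[OF subspace_sheet] by simp
  qed
  then have "sheet x = UNIV" by blast
  then have "DIM('a) = DIM('a) - 1" using dim_sheet[OF assms(1)] by simp
  then show False using DIM_positive[where 'a = 'a] by linarith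
qed

text \<open>The partner of \<open>x\<close> arises by changing the sign of \<open>X\<close> in the
  polar coordinates of \<open>x\<close>, so \<open>x\<close> determines it.\<close>

lemma no_triple_point:
  assumes "norm x = 1" "norm y = 1" "norm y' = 1" and "F x = F y" "F x = F y'" and "x \<noteq> y" "x \<noteq> y'"
  shows "y = y'"
proof -
  obtain X Y where 1: "y = x + J (Z y - Z x)" "Z x = csqrt (W x) * Complex X Y"
      "Z y = csqrt (W x) * Complex (- X) Y" "W x \<noteq> 0"
    using F_double_point[OF assms(1,2,4,6)] by metis
  obtain X' Y' where 2: "y' = x + J (Z y' - Z x)" "Z x = csqrt (W x) * Complex X' Y'"
      "Z y' = csqrt (W x) * Complex (- X') Y'"
    using F_double_point[OF assms(1,3,5,7)] by metis
  have "csqrt (W x) * Complex X Y = csqrt (W x) * Complex X' Y'"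
    by (rule trans[OF 1(2)[symmetric] 2(2)])
  then have "X = X'" "Y = Y'" using 1(4) by auto
  then have "Z y = Z y'" using 1(3) 2(3) by simp
  with 1(1) have "y = x + J (Z y' - Z x)" by (simp only:)
  then show ?thesis using 2(1) by (rule trans[OF _ sym])
qed

lemma differential_F:
  "h \<in> tangent_space (sphere 0 1) x \<Longrightarrow> differential (sphere 0 1) F x h = DF x h"
  by (rule differential_tangent[OF has_derivative_at_withinI[OF F_derivative]])

lemma immersion_F: "immersion (sphere 0 1) F"
proof -
  have "smooth_map (sphere 0 1) F"
    unfolding smooth_map_def smooth_on_open_def using F_smooth open_UNIV by blast
  moreover have "inj_on (differential (sphere 0 1) F x) (tangent_space (sphere 0 1) x)"
    if "x \<in> sphere 0 1" for x
  proof -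
    have x: "norm x = 1" using that by simp
    have "inj_on (differential (sphere 0 1) F x) (tangent_space (sphere 0 1) x) \<longleftrightarrow>
        inj_on (DF x) (tangent_space (sphere 0 1) x)"
      by (intro inj_on_cong differential_F)
    then show ?thesis using inj_on_D[OF x] tangent_space_sphere[OF x] by simp
  qed
  ultimately show ?thesis unfolding immersion_def by blast
qed

lemma self_transverse_F: "self_transverse_immersion (sphere 0 1) F"
  unfolding self_transverse_immersion_def
proof (intro conjI allI impI immersion_F, elim conjE)
  fix X :: "'a set" and w :: "'a \<Rightarrow> 'a"
  assume X: "finite X" "X \<subseteq> sphere 0 1" and eq: "\<forall>x\<in>X. \<forall>y\<in>X. F x = F y"
  have n: "norm x = 1" if "x \<in> X" for x using X that by auto
  have sheet: "\<exists>h. h \<in> tangent_space (sphere 0 1) x \<and> differential (sphere 0 1) F x h = v"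
    if "x \<in> X" "v \<in> sheet x" for x v
    using that(2) differential_F tangent_space_sphere[OF n[OF that(1)]] unfolding sheet_def by auto
  have "\<exists>u d. \<forall>x\<in>X. d x \<in> sheet x \<and> w x = u + d x"
  proof (cases "\<exists>x\<in>X. \<exists>y\<in>X. x \<noteq> y")
    case True
    then obtain x y where xy: "x \<in> X" "y \<in> X" "x \<noteq> y" by blast
    have X2: "X \<subseteq> {x, y}"
      using no_triple_point[of x y] n xy eq by blast
    \<comment> \<open>The difference of the two prescribed vectors is split between the sheets; the
      diagonal vector will be \<open>w x - a\<close>.\<close>
    obtain a b where ab: "a \<in> sheet x" "b \<in> sheet y" "w x - w y = a + b"
      using sheet_sum[of x y "w x - w y"] n xy eq by metis
    have "- b \<in> sheet y" using ab(2) by (rule subspace_neg[OF subspace_sheet])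
    define d where "d x' = (if x' = x then a else - b)" for x'
    have d: "d x = a" "d y = - b" using xy(3) by (simp_all add: d_def)
    have "d x' \<in> sheet x' \<and> w x' = (w x - a) + d x'" if "x' \<in> X" for x'
    proof -
      consider "x' = x" | "x' = y" using X2 \<open>x' \<in> X\<close> by blast
      then show ?thesis
      proof cases
        case 1
        then show ?thesis using d ab(1) by simp
      next
        case 2
        have "w y = (w x - a) + - b" using ab(3) by (simp add: algebra_simps)
        then show ?thesis using 2 d \<open>- b \<in> sheet y\<close> by simp
      qed
    qed
    then show ?thesis by blast
  next
    case False
    show ?thesis
    proof (cases "X = {}")
      case False
      then obtain x where "x \<in> X" by blast
      then have "\<forall>y\<in>X. 0 \<in> sheet y \<and> w y = w x + 0"
        using \<open>\<not> (\<exists>x\<in>X. \<exists>y\<in>X. x \<noteq> y)\<close> subspace_0[OF subspace_sheet] by auto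
      then show ?thesis by (intro exI[of _ "w x"] exI[of _ "\<lambda>y. 0"])
    qed simp
  qed
  then obtain u d where ud: "\<And>x. x \<in> X \<Longrightarrow> d x \<in> sheet x \<and> w x = u + d x" by blast
  have "\<exists>t. \<forall>x\<in>X. t x \<in> tangent_space (sphere 0 1) x \<and> differential (sphere 0 1) F x (t x) = d x"
    by (intro bchoice ballI sheet) (use ud in auto)
  then obtain t where t: "\<forall>x\<in>X. t x \<in> tangent_space (sphere 0 1) x \<and>
      differential (sphere 0 1) F x (t x) = d x" by blast
  show "\<exists>u t. \<forall>x\<in>X. t x \<in> tangent_space (sphere 0 1) x \<and>
      w x = u + differential (sphere 0 1) F x (t x)"
    by (intro exI[of _ u] exI[of _ t]) (use t ud in simp)
qed

section \<open>The loop of exchanged sheets\<close>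

text \<open>The squared radii 3/4 and 1/4 add up to 1. The diagonal \<open>s = t\<close> is the
  curve bounding the Moebius band; separate phases allow leaving it while \<open>w\<close> stays
  fixed.\<close>

definition helix :: "real \<Rightarrow> real \<Rightarrow> 'a" where
  "helix s t = J (of_real (sqrt 3 / 2) * cis s) + I (of_real (1 / 2) * cis (2 * t))"

lemma norm_helix: "norm (helix s t) = 1"
proof -
  have "(J a + I b) \<bullet> (J a + I b) = (cmod a)^2 + (cmod b)^2" for a b
    unfolding dot_square_norm[symmetric] by (simp add: inner_add)
  then have "helix s t \<bullet> helix s t =
      (cmod (of_real (sqrt 3 / 2) * cis s))^2 + (cmod (of_real (1 / 2) * cis (2 * t)))^2"
    unfolding helix_def .
  also have "\<dots> = 1" by (simp add: norm_mult power_divide power2_eq_square)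
  finally show ?thesis by (simp add: norm_eq_1)
qed

lemma coordinates_helix:
  "Z (helix s t) = of_real (sqrt 3 / 2) * cis s" "W (helix s t) = of_real (1 / 2) * cis (2 * t)"
  unfolding helix_def by (simp_all only: linear_coordinates coordinates) simp_all

lemma F_helix: "F (helix t t) = I (of_real (1 / 2) * cis (2 * t))"
proof -
  have scale: "quintic (of_real a * c) (of_real b * d) =
      of_real (5/3 * a^3 * b) * (c^3 * cnj d) + of_real (2 * a^3 * b^2) * (cnj c^3 * d^2)" for a b c d
    by (simp add: quintic_def power_mult_distrib)
  have c: "cis t ^ 3 * cnj (cis (2 * t)) = cis t" "cnj (cis t) ^ 3 * cis (2 * t) ^ 2 = cis t"
    unfolding cis_cnj Complex.DeMoivre cis_mult by simp_all
  have "(sqrt 3 / 2)^3 = 3/8 * sqrt 3" by (simp add: power3_eq_cube)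
  then have "5/3 * (sqrt 3 / 2)^3 * (1/2) + 2 * (sqrt 3 / 2)^3 * (1/2)^2 = sqrt 3 / 2"
    by (simp add: power2_eq_square)
  then have "quintic (of_real (sqrt 3 / 2) * cis t) (of_real (1 / 2) * cis (2 * t)) = of_real (sqrt 3 / 2) * cis t"
    unfolding scale c by (metis distrib_right of_real_add)
  then show ?thesis
    unfolding F_def coordinates_helix by (simp only: helix_def add_diff_cancel_left')
qed

text \<open>
  A point off the axis \<open>Y = 0\<close> but still close to it has too small a value of \<open>X\<^sup>2 - 3 * Y\<^sup>2\<close> to be a
  double point.
\<close>

lemma helix_single_point:
  assumes y: "norm y = 1" "F y = F (helix (t + \<epsilon>) t)" and \<epsilon>: "0 < \<epsilon>" "\<epsilon> \<le> 1"
  shows "y = helix (t + \<epsilon>) t"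
proof (rule ccontr)
  let ?x = "helix (t + \<epsilon>) t"
  assume "y \<noteq> ?x"
  then obtain X Y where z: "Z ?x = csqrt (W ?x) * Complex X Y"
      and S1: "re_coeff (cmod (W ?x)) * (X^2 - 3 * Y^2) = 1"
    using F_double_point[OF norm_helix y(1), of "t + \<epsilon>" t] y(2) by metis
  have w: "cmod (W ?x) = 1/2" by (simp add: coordinates_helix norm_mult)
  have "X^2 - 3 * Y^2 = 3/2" using S1 unfolding w re_coeff_def by (simp add: power2_eq_square power3_eq_cube)
  moreover have "X^2 + Y^2 = 3/2"
  proof -
    have "(cmod (Z ?x))^2 = 1/2 * (X^2 + Y^2)"
      unfolding z by (rule norm_polar) (simp add: norm_csqrt_square w)
    moreover have "(cmod (Z ?x))^2 = 3/4" by (simp add: coordinates_helix norm_mult power_divide)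
    ultimately show ?thesis by simp
  qed
  \<comment> \<open>The ratio of the squared modulus of \<open>z\<close> to the modulus of
    \<open>w\<close> is 3/2, which leaves \<open>Y = 0\<close>. Then \<open>z^2\<close> is a
    positive multiple of \<open>w\<close>, although their phases differ by
    \<open>2 * \<epsilon>\<close>, strictly between 0 and \<open>pi\<close>.\<close>
  ultimately have "Y^2 = 0" and X: "X^2 = 3/2" by linarith+
  then have Y: "Y = 0" by simp
  have "(Z ?x)^2 = W ?x * of_real (X^2)"
    unfolding z Y by (simp add: power_mult_distrib complex_of_real_def[symmetric])
  moreover have "(Z ?x)^2 = of_real (3/4) * (cis (2 * t) * cis (2 * \<epsilon>))"
  proof -
    have "cis (t + \<epsilon>) ^ 2 = cis (2 * t) * cis (2 * \<epsilon>)"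
      unfolding Complex.DeMoivre cis_mult by (simp add: distrib_left)
    moreover have "(complex_of_real (sqrt 3 / 2))^2 = of_real (3/4)"
      by (simp add: power_divide flip: of_real_power)
    ultimately show ?thesis unfolding coordinates_helix power_mult_distrib by (simp only:)
  qed
  moreover have "W ?x * of_real (X^2) = of_real (3/4) * (cis (2 * t) * 1)"
    unfolding X coordinates_helix by simp
  ultimately have "of_real (3/4) * (cis (2 * t) * cis (2 * \<epsilon>)) = of_real (3/4) * (cis (2 * t) * 1)"
    by (simp only:)
  then have "cis (2 * \<epsilon>) = 1" unfolding mult_cancel_left by (simp add: cis_neq_zero)
  then have "sin (2 * \<epsilon>) = 0" by (simp add: complex_eq_iff)
  moreover have "sin (2 * \<epsilon>) > 0" using \<epsilon> pi_gt3 by (intro sin_gt_zero) auto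
  ultimately show False by simp
qed

theorem immersed_sphere_F: "immersed_sphere (F ` sphere 0 1)"
  unfolding immersed_sphere_def using self_transverse_F by blast

theorem not_lifts_F:
  assumes "DIM('a) = n + 1"
  shows "\<not> lifts n (F ` sphere 0 1)"
proof
  assume "lifts n (F ` sphere 0 1)"
  then obtain K :: "('a \<times> real) set" and Or where K: "n_knot n K Or"
      "self_transverse_immersion K fst" "fst ` K = F ` sphere 0 1"
    unfolding lifts_def by blast
  interpret lifted_immersion F DF K n
    using K assms by unfold_locales (auto simp: n_knot_def intro: compact_pl_sphere)
  have half_turn: "helix (t + pi) (t + pi) \<noteq> helix t t" for t
  proof
    assume "helix (t + pi) (t + pi) = helix t t"
    then have "of_real (sqrt 3 / 2) * cis (t + pi) = of_real (sqrt 3 / 2) * cis t"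
      using coordinates_helix(1) by metis
    then show False by (simp add: cis_mult[symmetric])
  qed
  have double: "F (helix (t + pi) (t + pi)) = F (helix t t)" for t
    unfolding F_helix distrib_left by (simp add: cis_mult[symmetric])
  have cont: "continuous_on A (\<lambda>t. helix (a t) (b t))" if "continuous_on A a" "continuous_on A b" for A a b
    unfolding helix_def
    by (intro continuous_intros bounded_linear.continuous_on[OF bounded_linear_coordinates(3)]
        bounded_linear.continuous_on[OF bounded_linear_coordinates(4)] that continuous_on_cis)
  show False
  proof (rule no_sheet_exchange[of "\<lambda>t. helix t t"])
    show "continuous_on UNIV (\<lambda>t. helix t t)" by (intro cont continuous_intros)
    show "norm (helix t t) = 1" for t by (rule norm_helix)
    show "helix (t + 2 * pi) (t + 2 * pi) = helix t t" for t
    proof -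
      have "cis (2 * (2 * pi)) = cis (2 * pi) * cis (2 * pi)" unfolding cis_mult by simp
      then show ?thesis unfolding helix_def distrib_left by (simp add: cis_mult[symmetric])
    qed
    show "F (helix (t + pi) (t + pi)) = F (helix t t)" for t by (rule double)
    show "sheet (helix (t + pi) (t + pi)) \<noteq> sheet (helix t t)" for t
      using sheets_differ[OF norm_helix norm_helix double[symmetric] half_turn[symmetric]] .
    fix t :: real
    \<comment> \<open>The phase of \<open>z\<close> runs ahead by 1/(i+1), which lies in the range
      allowed by \<open>helix_single_point\<close>.\<close>
    define x where "x i = helix (t + 1 / real (Suc i)) t" for i
    have "isCont (\<lambda>\<epsilon>. helix (t + \<epsilon>) t) 0"
      using cont[of UNIV "\<lambda>\<epsilon>. t + \<epsilon>" "\<lambda>_. t"]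
      by (auto intro!: continuous_intros simp: continuous_on_eq_continuous_at)
    then have "(\<lambda>i. helix (t + 1 / real (Suc i)) t) \<longlonglongrightarrow> helix (t + 0) t"
      using LIMSEQ_Suc[OF lim_1_over_n] by (rule isCont_tendsto_compose)
    then have "x \<longlonglongrightarrow> helix t t" unfolding x_def by simp
    moreover have "norm (x i) = 1 \<and> (\<forall>y. norm y = 1 \<longrightarrow> F y = F (x i) \<longrightarrow> y = x i)" for i
      unfolding x_def using helix_single_point[of _ t "1 / real (Suc i)"] norm_helix by simp
    ultimately show "\<exists>x. x \<longlonglongrightarrow> helix t t \<and>
        (\<forall>i. norm (x i) = 1 \<and> (\<forall>y. norm y = 1 \<longrightarrow> F y = F (x i) \<longrightarrow> y = x i))"
      by blast
  qed
qed

end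

theorem theorem4p1:
  fixes n :: nat
  assumes "n > 2" and "CARD('m::finite) = n + 1"
  shows "\<exists>A :: (real ^ 'm) set. immersed_sphere A \<and> \<not> lifts n A"
proof -
  \<comment> \<open>The hypothesis \<open>n > 2\<close> provides four coordinate axes, enough for
    two complex coordinates.\<close>
  have "4 \<le> card (UNIV :: 'm set)" using assms by simp
  then obtain T :: "'m set" where "card T = 4" by (metis obtain_subset_with_card_n)
  then obtain i j k l :: 'm where ijkl: "i \<noteq> j" "i \<noteq> k" "i \<noteq> l" "j \<noteq> k" "j \<noteq> l" "k \<noteq> l"
    by (auto simp: numeral_eq_Suc card_Suc_eq)
  interpret two_complex_coordinates "axis i 1" "axis j 1" "axis k 1" "axis l 1 :: real ^ 'm"
    using ijkl by unfold_locales (auto simp: inner_axis_axis)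
  have "DIM(real ^ 'm) = n + 1" using assms by simp
  then show ?thesis using immersed_sphere_F not_lifts_F by blast
qed

end
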